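(* Let $K$ be a field, let $k\geq 3$ be an integer, and let $n,d$ be positive integers with $k\leq d<kn$. Let $I_{k,n,d}\subset S=K[x_1,\ldots,x_n]$ be the Veronese type ideal with constant bound $k$. Then $I_{k,n,d}$ is Freiman if and only if one of the following conditions holds: (a) $n=2$ and $d\in\{k,\ldots,2k-1\}$; (b) $n=3$ and $d=3k-2$ or $d=3k-1$; (c) $n\geq 4$ and $d=kn-1$.
   Context: For positive integers $k,n,d$ with $k\leq d$ and $kn>d$, the Veronese type ideal with constant bound $k$ is the monomial ideal $I_{k,n,d}\subset S=K[x_1,\ldots,x_n]$ whose minimal monomial generators are the monomials $x_1^{b_1}\cdots x_n^{b_n}$ with $\sum_{i=1}^n b_i=d$ and $0\leq b_i\leq k$ for all $i$. For an equigenerated monomial ideal $I\subset S$ (all minimal generators of the same degree), let $\mu(I)$ denote its minimal number of generators and $\ell(I)$ its analytic spread, i.e. the Krull dimension of the fiber cone $F(I)=\bigoplus_{j\ge 0} I^j/\mathfrak{m}I^j$, where $\mathfrak{m}=(x_1,\ldots,x_n)$. The ideal $I$ is called Freiman if $\mu(I^2)=\ell(I)\mu(I)-\binom{\ell(I)}{2}$. *)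

theory Defs
  imports
    "HOL-Algebra.Algebra"
    "HOL-Algebra.Algebraic_Closure_Type"
    "HOL-Computational_Algebra.Polynomial"
    "HOL-Library.Poly_Mapping"
    "HOL-Library.Extended_Nat"
begin

text \<open>A polynomial over \<open>'a\<close> in the variables \<open>x\<^sub>0, x\<^sub>1, \<dots>\<close> maps exponent vectors to coefficients,
  finitely many of which are nonzero.\<close>

type_synonym 'a mpol = "(nat \<Rightarrow>\<^sub>0 nat) \<Rightarrow>\<^sub>0 'a"

text \<open>The ring \<open>K[x\<^sub>0, \<dots>, x\<^sub>n\<^sub>-\<^sub>1]\<close>; variables are numbered from 0.\<close>

definition mpol_ring :: "nat \<Rightarrow> 'a::field mpol ring" where
  "mpol_ring n =
     ring_of_type_algebra
       \<lparr>carrier := {p. \<forall>b\<in>Poly_Mapping.keys p. Poly_Mapping.keys b \<subseteq> {..<n}}\<rparr>"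

definition monomial :: "(nat \<Rightarrow>\<^sub>0 nat) \<Rightarrow> 'a::field mpol" where
  "monomial b = Poly_Mapping.single b 1"

definition variables_ideal :: "nat \<Rightarrow> 'a::field mpol set" where
  "variables_ideal n =
     Idl\<^bsub>mpol_ring n\<^esub> {monomial (Poly_Mapping.single i 1) | i. i < n}"

definition veronese_ideal :: "nat \<Rightarrow> nat \<Rightarrow> nat \<Rightarrow> 'a::field mpol set" where
  "veronese_ideal k n d =
     Idl\<^bsub>mpol_ring n\<^esub> {monomial b | b.
        Poly_Mapping.keys b \<subseteq> {..<n} \<and>
        (\<Sum>i<n. Poly_Mapping.lookup b i) = d \<and>
        (\<forall>i<n. Poly_Mapping.lookup b i \<le> k)}"

definition ideal_power :: "('a, 'm) ring_scheme \<Rightarrow> 'a set \<Rightarrow> nat \<Rightarrow> 'a set" where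
  "ideal_power R I j = I [^]\<^bsub>ideals_set R\<^esub> j"

definition min_num_gens :: "('a, 'm) ring_scheme \<Rightarrow> 'a set \<Rightarrow> nat" where
  "min_num_gens R I =
     (LEAST m. \<exists>A. A \<subseteq> carrier R \<and> finite A \<and> card A = m \<and> Idl\<^bsub>R\<^esub> A = I)"

text \<open>The supremum of the lengths \<open>l\<close> of strict chains \<open>P\<^sub>0 \<subset> \<dots> \<subset> P\<^sub>l\<close> of prime ideals.\<close>

definition krull_dim :: "('a, 'm) ring_scheme \<Rightarrow> enat" where
  "krull_dim R =
     Sup {enat l | l. \<exists>P :: nat \<Rightarrow> 'a set.
        (\<forall>i\<le>l. primeideal (P i) R) \<and> (\<forall>i<l. P i \<subset> P (Suc i))}"

text \<open>The direct sum of a sequence \<open>J\<^sub>0, J\<^sub>1, \<dots>\<close> of subsets of \<open>S\<close>, realised as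
  \<open>\<Oplus>\<^sub>j J\<^sub>j t\<^sup>j\<close> inside \<open>S[t]\<close>, so that the multiplication of \<open>S[t]\<close> restricts to the graded one.\<close>

definition graded_sum :: "(nat \<Rightarrow> 'a::field mpol set) \<Rightarrow> 'a mpol poly set" where
  "graded_sum J = {f. \<forall>j. Polynomial.coeff f j \<in> J j}"

definition rees_ring :: "nat \<Rightarrow> 'a::field mpol set \<Rightarrow> 'a mpol poly ring" where
  "rees_ring n I =
     ring_of_type_algebra\<lparr>carrier := graded_sum (ideal_power (mpol_ring n) I)\<rparr>"

text \<open>Two elements of \<open>\<Oplus>\<^sub>j I\<^sup>j\<close> are identified iff for every \<open>j\<close> their components in degree \<open>j\<close>
  are congruent modulo \<open>\<mm> I\<^sup>j\<close>, so this quotient is \<open>\<Oplus>\<^sub>j I\<^sup>j / \<mm> I\<^sup>j\<close>.\<close>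

definition fiber_cone :: "nat \<Rightarrow> 'a::field mpol set \<Rightarrow> 'a mpol poly set ring" where
  "fiber_cone n I =
     rees_ring n I Quot
       graded_sum (\<lambda>j. ideal_prod (mpol_ring n) (variables_ideal n) (ideal_power (mpol_ring n) I j))"

definition analytic_spread :: "nat \<Rightarrow> 'a::field mpol set \<Rightarrow> enat" where
  "analytic_spread n I = krull_dim (fiber_cone n I)"

text \<open>Meant for equigenerated monomial ideals \<open>I\<close>. The equation is read in the integers, and the
  analytic spread is required to be finite (which it always is for ideals of \<open>K[x\<^sub>0, \<dots>, x\<^sub>n\<^sub>-\<^sub>1]\<close>).\<close>

definition freiman :: "nat \<Rightarrow> 'a::field mpol set \<Rightarrow> bool" where
  "freiman n I \<longleftrightarrow>
     (\<exists>l. analytic_spread n I = enat l \<and>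
        int (min_num_gens (mpol_ring n) (ideal_power (mpol_ring n) I 2)) =
          int l * int (min_num_gens (mpol_ring n) I) - int (l choose 2))"

end

theory Submission
  imports Defs
begin

text \<open>
  Let \<open>A\<close> be the set of exponent vectors of the generators, that is, the set of integer points of
  the slice \<open>a\<^sub>0 + \<dots> + a\<^sub>n\<^sub>-\<^sub>1 = d\<close> of the cube \<open>[0, k]\<^sup>n\<close>. The proof translates the Freiman
  equation into a statement about the sizes of \<open>A\<close> and \<open>A + A\<close> and then decides that statement by
  counting.

  The number of generators. The generators of the ideal all have the same degree, so the parts of
  that degree of any generating set span the linear space spanned by the given monomials; hence no
  generating set is smaller than \<open>A\<close> (\<open>min_num_gens_monomial_ideal\<close>). The square of the ideal is
  generated by the monomials with exponents in \<open>A + A\<close>, and this is the slice for \<open>2 k\<close> and \<open>2 d\<close>,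
  because a vector can be halved by distributing its odd coordinates evenly
  (\<open>bounded_vectors_double\<close>).

  The analytic spread. Keeping in degree \<open>j\<close> only the monomials of the least possible degree
  \<open>j d\<close> identifies the fiber cone with the subalgebra spanned by the monomials whose exponents
  lie in the monoid generated by \<open>A\<close> (\<open>krull_dim_fiber_cone\<close>). That algebra has Krull dimension
  \<open>n\<close>. It is at most \<open>n\<close>, since counting monomials shows that \<open>n + 1\<close> polynomials in \<open>n\<close> variables
  satisfy a polynomial relation, whereas elements that witness the strict inclusions of a chain of
  primes satisfy none (\<open>prime_chain_no_relation\<close>, \<open>algebraic_dependence\<close>). It is at least \<open>n\<close>
  because forgetting one coordinate of the exponents after the other produces a chain of kernels of
  ring homomorphisms into a domain (\<open>krull_dim_toric_ring_ge\<close>).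

  The count. What remains is to decide when \<open>|A + A| = n |A| - n (n - 1) / 2\<close>. Sort the
  elements \<open>s\<close> of \<open>A + A\<close> by the number of their odd coordinates. Those without odd coordinates are
  the vectors \<open>2 a\<close>. Those with exactly two are obtained, each in two ways, from some \<open>2 a\<close> by
  moving one unit from a coordinate to another. If \<open>a\<close> has \<open>z\<close> zeros, \<open>t\<close> coordinates equal to \<open>k\<close> and
  \<open>m\<close> others, then there are \<open>t z + m (n - 1)\<close> such moves, which is at least \<open>2 (n - 1)\<close> unless
  \<open>m \<le> 1\<close>, that is, unless \<open>a\<close> is a vertex of the slice. There are so few vertices that their
  total shortage is at most \<open>n (n - 1)\<close> (\<open>sum_transfer_pairs_ge\<close>). This proves
  \<open>|A + A| \<ge> n |A| - n (n - 1) / 2\<close>, and the inequality is strict if some \<open>s\<close> has four odd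
  coordinates or some \<open>a\<close> has \<open>m \<ge> 3\<close>. For \<open>n \<ge> 3\<close> one of the two happens except in the listed
  cases (\<open>card_bounded_vectors_double_greater\<close>). In the listed cases \<open>k n - d \<le> k\<close>, so after passing to
  the complements \<open>k - a\<^sub>i\<close> the upper bounds on the coordinates become vacuous and both sizes are
  binomial coefficients.
\<close>

section \<open>Sums of integer points of a slice of a cube\<close>

definition bounded_vectors :: "nat \<Rightarrow> nat \<Rightarrow> nat \<Rightarrow> (nat \<Rightarrow> nat) set" where
  "bounded_vectors k n d =
     {b. (\<forall>i\<ge>n. b i = 0) \<and> (\<forall>i. b i \<le> k) \<and> (\<Sum>i<n. b i) = d}"

lemma bounded_vectorsI:
  assumes "\<And>i. i \<ge> n \<Longrightarrow> b i = 0" "\<And>i. i < n \<Longrightarrow> b i \<le> k" "(\<Sum>i<n. b i) = d"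
  shows "b \<in> bounded_vectors k n d"
proof -
  have "b i \<le> k" for i
    using assms(1,2)[of i] by (cases "i < n") auto
  then show ?thesis
    unfolding bounded_vectors_def using assms(1,3) by blast
qed

lemma bounded_vectorsD:
  assumes "b \<in> bounded_vectors k n d"
  shows "\<And>i. i \<ge> n \<Longrightarrow> b i = 0" "\<And>i. b i \<le> k" "(\<Sum>i<n. b i) = d"
  using assms by (auto simp: bounded_vectors_def)

lemma bounded_vectors_eqI:
  assumes "a \<in> bounded_vectors k n d" "b \<in> bounded_vectors k' n d'"
    and "\<And>i. i < n \<Longrightarrow> a i = b i"
  shows "a = b"
  using assms by (intro ext) (metis bounded_vectorsD(1) not_less)

lemma finite_bounded_vectors [simp]: "finite (bounded_vectors k n d)"
proof (rule finite_subset)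
  show "bounded_vectors k n d \<subseteq>
          {b. \<forall>i. (i \<in> {..<n} \<longrightarrow> b i \<in> {..k}) \<and> (i \<notin> {..<n} \<longrightarrow> b i = 0)}"
    by (auto simp: bounded_vectors_def)
  show "finite {b. \<forall>i. (i \<in> {..<n} \<longrightarrow> b i \<in> {..k}) \<and> (i \<notin> {..<n} \<longrightarrow> b i = (0::nat))}"
    by (rule finite_set_of_finite_funs) auto
qed

lemma sum_below_bounds_ex:
  fixes u :: "nat \<Rightarrow> nat"
  assumes "N \<le> (\<Sum>i<n. u i)"
  shows "\<exists>c. (\<forall>i. c i \<le> u i) \<and> (\<forall>i\<ge>n. c i = 0) \<and> (\<Sum>i<n. c i) = N"
  using assms
proof (induction n arbitrary: N)
  case 0
  then show ?case by (intro exI[of _ "\<lambda>_. 0"]) auto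
next
  case (Suc n)
  define x where "x = min N (u n)"
  have "N - x \<le> (\<Sum>i<n. u i)" using Suc.prems by (auto simp: x_def)
  from Suc.IH[OF this] obtain c where c: "\<forall>i. c i \<le> u i" "\<forall>i\<ge>n. c i = 0" "(\<Sum>i<n. c i) = N - x"
    by blast
  have "(\<Sum>i<n. (c(n := x)) i) = (\<Sum>i<n. c i)" by (intro sum.cong) auto
  with c show ?case
    by (intro exI[of _ "c(n := x)"]) (auto simp: x_def)
qed

definition odd_positions :: "(nat \<Rightarrow> nat) \<Rightarrow> nat set" where
  "odd_positions s = {i. odd (s i)}"

lemma odd_positions_subset:
  assumes "s \<in> bounded_vectors k n d"
  shows "odd_positions s \<subseteq> {..<n}"
proof
  fix i assume "i \<in> odd_positions s"
  then have "s i \<noteq> 0" by (auto simp: odd_positions_def elim: oddE)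
  then show "i \<in> {..<n}" using bounded_vectorsD(1)[OF assms, of i] by (meson lessThan_iff not_less)
qed

lemma sum_halves:
  assumes "s \<in> bounded_vectors k n d"
  shows "2 * (\<Sum>i<n. s i div 2) + card (odd_positions s) = d"
proof -
  have "d = (\<Sum>i<n. 2 * (s i div 2) + s i mod 2)"
    unfolding mult_div_mod_eq by (rule bounded_vectorsD(3)[OF assms, symmetric])
  also have "\<dots> = 2 * (\<Sum>i<n. s i div 2) + (\<Sum>i<n. s i mod 2)"
    by (simp only: sum.distrib sum_distrib_left)
  also have "(\<Sum>i<n. s i mod 2) = (\<Sum>i\<in>odd_positions s. 1)"
    using odd_positions_subset[OF assms]
    by (intro sum.mono_neutral_cong_right) (auto simp: odd_positions_def odd_iff_mod_2_eq_one)
  finally show ?thesis by simp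
qed

text \<open>
  The odd coordinates of \<open>s\<close> are even in number. Rounding half of them up and the other half down
  in \<open>s / 2\<close> gives one summand, the opposite choice gives the other; since \<open>2 k\<close> is even, an odd
  coordinate of \<open>s\<close> stays at most \<open>k\<close> even when rounded up.
\<close>

lemma bounded_vectors_double:
  "bounded_vectors (2 * k) n (2 * d) =
     {\<lambda>i. a i + b i |a b. a \<in> bounded_vectors k n d \<and> b \<in> bounded_vectors k n d}"
proof (intro equalityI subsetI)
  fix s assume s: "s \<in> bounded_vectors (2 * k) n (2 * d)"
  note D = bounded_vectorsD[OF s]
  let ?O = "odd_positions s" and ?h = "\<Sum>i<n. s i div 2"
  have h: "2 * ?h + card ?O = 2 * d" by (rule sum_halves[OF s])
  have On: "?O \<subseteq> {..<n}" by (rule odd_positions_subset[OF s])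
  then have fin: "finite ?O" using finite_subset by blast
  obtain P where P: "P \<subseteq> ?O" "card P = card ?O div 2"
    by (metis obtain_subset_with_card_n div_le_dividend)
  have cardQ: "card (odd_positions s - P) = card (odd_positions s) div 2"
  proof -
    have "card (?O - P) = card ?O - card ?O div 2"
      using P card_Diff_subset[of P ?O] finite_subset[OF P(1) fin] by simp
    moreover have "card (odd_positions s) = 2 * (d - (\<Sum>i<n. s i div 2))" using h by linarith
    ultimately show ?thesis by simp
  qed
  have half: "(\<lambda>i. s i div 2 + of_bool (i \<in> Y)) \<in> bounded_vectors k n d"
    if Y: "Y \<subseteq> ?O" "card Y = card ?O div 2" for Y
  proof (rule bounded_vectorsI)
    fix i
    show "s i div 2 + of_bool (i \<in> Y) = 0" if "i \<ge> n" using that Y On D(1) by auto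
    show "s i div 2 + of_bool (i \<in> Y) \<le> k"
    proof (cases "i \<in> Y")
      case True
      then have "odd (s i)" using Y by (auto simp: odd_positions_def)
      then show ?thesis using D(2)[of i] True by (auto elim!: oddE)
    next
      case False
      then show ?thesis using D(2)[of i] by auto
    qed
  next
    have "(\<Sum>i<n. (of_bool (i \<in> Y) :: nat)) = card Y"
      using Y On by (subst sum.mono_neutral_cong_right[where S = Y and h = "\<lambda>_. 1"]) auto
    then show "(\<Sum>i<n. s i div 2 + of_bool (i \<in> Y)) = d"
      using Y h by (simp add: sum.distrib)
  qed
  have "s = (\<lambda>i. (s i div 2 + of_bool (i \<in> P)) + (s i div 2 + of_bool (i \<in> ?O - P)))"
  proof
    fix i
    show "s i = (s i div 2 + of_bool (i \<in> P)) + (s i div 2 + of_bool (i \<in> ?O - P))"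
    proof (cases "odd (s i)")
      case True
      then have "of_bool (i \<in> P) + of_bool (i \<in> ?O - P) = (1 :: nat)"
        by (auto simp: odd_positions_def)
      then show ?thesis using odd_two_times_div_two_succ[OF True] by linarith
    next
      case False
      have "i \<notin> ?O" "i \<notin> P" using False P(1) by (auto simp: odd_positions_def)
      moreover have "s i = 2 * (s i div 2)" using even_two_times_div_two[of "s i"] False by simp
      ultimately show ?thesis by simp
    qed
  qed
  with half[OF P] half[OF Diff_subset cardQ]
  show "s \<in> {\<lambda>i. a i + b i |a b. a \<in> bounded_vectors k n d \<and> b \<in> bounded_vectors k n d}"
    by (intro CollectI exI[of _ "\<lambda>i. s i div 2 + of_bool (i \<in> P)"]
        exI[of _ "\<lambda>i. s i div 2 + of_bool (i \<in> ?O - P)"] conjI)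
next
  fix s assume "s \<in> {\<lambda>i. a i + b i |a b. a \<in> bounded_vectors k n d \<and> b \<in> bounded_vectors k n d}"
  then show "s \<in> bounded_vectors (2 * k) n (2 * d)"
    by (auto intro!: add_mono simp: bounded_vectors_def sum.distrib mult_2)
qed

section \<open>Counting sums by their odd coordinates\<close>

text \<open>
  The pairs \<open>(i, j)\<close> such that one unit can be moved from coordinate \<open>i\<close> to coordinate \<open>j\<close> of \<open>a\<close>
  without leaving the cube.
\<close>

definition transfer_pairs :: "nat \<Rightarrow> nat \<Rightarrow> (nat \<Rightarrow> nat) \<Rightarrow> (nat \<times> nat) set" where
  "transfer_pairs k n a = {(i, j). i < n \<and> j < n \<and> i \<noteq> j \<and> 0 < a i \<and> a j < k}"

lemma finite_transfer_pairs [simp]: "finite (transfer_pairs k n a)"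
  by (rule finite_subset[of _ "{..<n} \<times> {..<n}"]) (auto simp: transfer_pairs_def)

lemma sum_fun_upd2:
  fixes a :: "nat \<Rightarrow> nat"
  assumes "i < n" "j < n" "i \<noteq> j"
  shows "(\<Sum>l<n. (a(i := x, j := y)) l) + a i + a j = (\<Sum>l<n. a l) + x + y"
proof -
  have eq: "{..<n} = insert i (insert j ({..<n} - {i, j}))" using assms by auto
  have "(\<Sum>l\<in>{..<n} - {i, j}. (a(i := x, j := y)) l) = (\<Sum>l\<in>{..<n} - {i, j}. a l)"
    by (intro sum.cong) auto
  then show ?thesis
    using assms by (subst (1 2) eq) (auto simp: sum.insert)
qed

text \<open>
  Moving one unit from coordinate \<open>i\<close> to coordinate \<open>j\<close> of \<open>2 a\<close> gives a vector of the doubled slice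
  whose odd coordinates are exactly \<open>i\<close> and \<open>j\<close>. The result together with \<open>i\<close> determines \<open>a\<close> and \<open>j\<close>,
  so every vector with two odd coordinates is hit at most twice.
\<close>

lemma sum_transfer_pairs_le:
  "(\<Sum>a\<in>bounded_vectors k n d. card (transfer_pairs k n a)) \<le>
     2 * card {s \<in> bounded_vectors (2 * k) n (2 * d). card (odd_positions s) = 2}"
proof -
  let ?A = "bounded_vectors k n d"
  let ?S = "{s \<in> bounded_vectors (2 * k) n (2 * d). card (odd_positions s) = 2}"
  \<comment> \<open>The second component remembers which of the two odd coordinates lost a unit.\<close>
  define F :: "(nat \<Rightarrow> nat) \<times> nat \<times> nat \<Rightarrow> (nat \<Rightarrow> nat) \<times> nat"
    where "F = (\<lambda>(a, i, j). ((\<lambda>l. 2 * a l)(i := 2 * a i - 1, j := 2 * a j + 1), i))"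
  let ?T = "Sigma ?A (transfer_pairs k n)"
  have odd: "odd_positions (fst (F (a, i, j))) = {i, j}" if "0 < a i" "i \<noteq> j" for a i j
    using that by (auto simp: F_def odd_positions_def split: if_splits)
  have inj: "inj_on F ?T"
  proof (rule inj_onI)
    fix x y assume xy: "x \<in> ?T" "y \<in> ?T" "F x = F y"
    obtain a i j where x: "x = (a, i, j)" by (cases x)
    obtain a' i' j' where y: "y = (a', i', j')" by (cases y)
    have A: "0 < a i" "i \<noteq> j" "0 < a' i'" "i' \<noteq> j'"
      using xy by (auto simp: x y transfer_pairs_def)
    have "i = i'" using xy(3) by (simp add: x y F_def)
    moreover have "{i, j} = {i', j'}"
      using odd[of a i j, OF A(1,2)] odd[of a' i' j', OF A(3,4)] xy(3) by (simp add: x y)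
    ultimately have ij: "i = i'" "j = j'" using A by (auto simp: doubleton_eq_iff)
    have eq: "((\<lambda>l. 2 * a l)(i := 2 * a i - 1, j := 2 * a j + 1)) l =
              ((\<lambda>l. 2 * a' l)(i := 2 * a' i - 1, j := 2 * a' j + 1)) l" for l
      using xy(3) unfolding x y F_def ij by (auto dest: fun_cong)
    have "a l = a' l" for l
      using eq[of l] A ij by (auto split: if_splits)
    then show "x = y" by (auto simp: x y ij)
  qed
  have img: "F ` ?T \<subseteq> Sigma ?S odd_positions"
  proof
    fix y assume "y \<in> F ` ?T"
    then obtain a i j where y: "y = F (a, i, j)" and a: "a \<in> ?A" and p: "(i, j) \<in> transfer_pairs k n a"
      by auto
    note D = bounded_vectorsD[OF a]
    have ij: "i < n" "j < n" "i \<noteq> j" "0 < a i" "a j < k"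
      using p by (auto simp: transfer_pairs_def)
    have "fst y \<in> bounded_vectors (2 * k) n (2 * d)"
    proof (rule bounded_vectorsI)
      show "fst y l = 0" if "l \<ge> n" for l using that ij D(1) by (auto simp: y F_def)
      show "fst y l \<le> 2 * k" for l using D(2)[of l] ij by (auto simp: y F_def)
      have "(\<Sum>l<n. 2 * a l) = 2 * d" using D(3) by (simp add: sum_distrib_left[symmetric])
      then show "(\<Sum>l<n. fst y l) = 2 * d"
        using sum_fun_upd2[OF ij(1-3), of "\<lambda>l. 2 * a l" "2 * a i - 1" "2 * a j + 1"] ij(4)
        by (simp add: y F_def)
    qed
    moreover have "odd_positions (fst y) = {i, j}" using odd ij y by blast
    moreover have "snd y = i" by (simp add: y F_def)
    ultimately show "y \<in> Sigma ?S odd_positions"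
      using ij(3) by (cases y) auto
  qed
  have fin: "finite (Sigma ?S odd_positions)"
    using odd_positions_subset finite_subset by (intro finite_SigmaI) (auto intro: card_ge_0_finite)
  have "(\<Sum>a\<in>?A. card (transfer_pairs k n a)) = card ?T"
    by (subst card_SigmaI) auto
  also have "\<dots> = card (F ` ?T)" using inj by (simp add: card_image)
  also have "\<dots> \<le> card (Sigma ?S odd_positions)" by (rule card_mono[OF fin img])
  also have "\<dots> = (\<Sum>s\<in>?S. card (odd_positions s))"
    by (subst card_SigmaI) (auto intro: card_ge_0_finite)
  also have "\<dots> = 2 * card ?S" by simp
  finally show ?thesis .
qed

text \<open>
  Doubling a vector makes all coordinates even, so the three sets that are counted on the left are
  disjoint.
\<close>

lemma card_bounded_vectors_double_ge:
  defines "S \<equiv> \<lambda>m k n d. {s \<in> bounded_vectors (2 * k) n (2 * d). card (odd_positions s) = m}"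
  shows "card (bounded_vectors k n d) + card (S 2 k n d) + card (S 4 k n d) \<le>
           card (bounded_vectors (2 * k) n (2 * d))"
proof -
  let ?A = "bounded_vectors k n d"
  let ?E = "(\<lambda>a l. 2 * a l) ` ?A"
  have inj: "inj_on (\<lambda>a l. 2 * a l :: nat) ?A"
    by (rule inj_onI) (auto simp: fun_eq_iff)
  have E0: "odd_positions s = {}" if "s \<in> ?E" for s using that by (auto simp: odd_positions_def)
  have "card ?A + card (S 2 k n d) + card (S 4 k n d) = card (?E \<union> S 2 k n d \<union> S 4 k n d)"
    using E0 by (subst card_Un_disjoint; (subst card_Un_disjoint)?) (auto simp: S_def card_image[OF inj])
  also have "\<dots> \<le> card (bounded_vectors (2 * k) n (2 * d))"
  proof (rule card_mono)
    have "?E \<subseteq> bounded_vectors (2 * k) n (2 * d)"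
      by (auto simp: bounded_vectors_def sum_distrib_left[symmetric])
    then show "?E \<union> S 2 k n d \<union> S 4 k n d \<subseteq> bounded_vectors (2 * k) n (2 * d)"
      by (auto simp: S_def)
  qed simp
  finally show ?thesis .
qed

definition zero_positions :: "nat \<Rightarrow> (nat \<Rightarrow> nat) \<Rightarrow> nat set" where
  "zero_positions n a = {i. i < n \<and> a i = 0}"

definition full_positions :: "nat \<Rightarrow> nat \<Rightarrow> (nat \<Rightarrow> nat) \<Rightarrow> nat set" where
  "full_positions k n a = {i. i < n \<and> a i = k}"

definition interior_positions :: "nat \<Rightarrow> nat \<Rightarrow> (nat \<Rightarrow> nat) \<Rightarrow> nat set" where
  "interior_positions k n a = {i. i < n \<and> 0 < a i \<and> a i < k}"

lemma finite_positions [simp]: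
  "finite (zero_positions n a)" "finite (full_positions k n a)" "finite (interior_positions k n a)"
  by (auto simp: zero_positions_def full_positions_def interior_positions_def)

lemma positions_partition:
  assumes "a \<in> bounded_vectors k n d" "k > 0"
  shows "card (zero_positions n a) + card (full_positions k n a) + card (interior_positions k n a) = n"
proof -
  have "n = card (zero_positions n a \<union> full_positions k n a \<union> interior_positions k n a)"
  proof -
    have "zero_positions n a \<union> full_positions k n a \<union> interior_positions k n a = {..<n}"
      using bounded_vectorsD(2)[OF assms(1)]
      by (auto simp: zero_positions_def full_positions_def interior_positions_def le_neq_implies_less)
    then show ?thesis by simp
  qed
  also have "\<dots> = card (zero_positions n a) + card (full_positions k n a) + card (interior_positions k n a)"
    using assms(2)
    by (subst card_Un_disjoint; (subst card_Un_disjoint)?)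
      (auto simp: zero_positions_def full_positions_def interior_positions_def)
  finally show ?thesis by simp
qed

text \<open>
  A unit can be taken from the \<open>t + m\<close> nonzero coordinates and given to the \<open>z + m\<close> coordinates
  below \<open>k\<close>; of these \<open>(t + m) (z + m)\<close> pairs the \<open>m\<close> diagonal ones are excluded. Now use
  \<open>n = z + t + m\<close>.
\<close>

lemma card_transfer_pairs:
  assumes "a \<in> bounded_vectors k n d" "k > 0"
  shows "card (transfer_pairs k n a) =
           card (full_positions k n a) * card (zero_positions n a)
           + card (interior_positions k n a) * (n - 1)"
proof -
  let ?Z = "zero_positions n a" and ?T = "full_positions k n a" and ?M = "interior_positions k n a"
  have disj: "?M \<inter> ?T = {}" "?M \<inter> ?Z = {}" "?T \<inter> ?Z = {}"
    using assms(2) by (auto simp: zero_positions_def full_positions_def interior_positions_def)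
  have less: "a i < k \<longleftrightarrow> a i \<noteq> k" for i
    using bounded_vectorsD(2)[OF assms(1), of i] by auto
  have P: "?M \<union> ?T = {i. i < n \<and> 0 < a i}" and Q: "?M \<union> ?Z = {j. j < n \<and> a j < k}"
    unfolding zero_positions_def full_positions_def interior_positions_def less
    using assms(2) by auto
  have eq: "transfer_pairs k n a \<union> (\<lambda>i. (i, i)) ` ?M = (?M \<union> ?T) \<times> (?M \<union> ?Z)"
    unfolding P Q unfolding transfer_pairs_def interior_positions_def by auto
  have "card (transfer_pairs k n a) + card ?M = card (transfer_pairs k n a \<union> (\<lambda>i. (i, i)) ` ?M)"
  proof -
    have "transfer_pairs k n a \<inter> (\<lambda>i. (i, i)) ` ?M = {}" by (auto simp: transfer_pairs_def)
    then show ?thesis by (simp add: card_Un_disjoint card_image inj_on_def)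
  qed
  also have "\<dots> = (card ?M + card ?T) * (card ?M + card ?Z)"
    unfolding eq card_cartesian_product using disj by (simp add: card_Un_disjoint)
  finally have *: "card (transfer_pairs k n a) + card ?M = (card ?M + card ?T) * (card ?M + card ?Z)" .
  have n: "n = card ?Z + card ?T + card ?M" using positions_partition[OF assms] by simp
  show ?thesis
  proof (cases "card ?M")
    case 0
    then show ?thesis using * by simp
  next
    case (Suc m)
    have "card (transfer_pairs k n a) + Suc m =
            card ?T * card ?Z + Suc m * (n - 1) + Suc m"
    proof -
      have "card (transfer_pairs k n a) + Suc m = (Suc m + card ?T) * (Suc m + card ?Z)"
        using * Suc by simp
      also have "n - 1 = card ?Z + card ?T + m" using n Suc by simp
      then have "(Suc m + card ?T) * (Suc m + card ?Z) = card ?T * card ?Z + Suc m * (n - 1) + Suc m"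
        by (simp add: algebra_simps)
      finally show ?thesis .
    qed
    then show ?thesis using Suc by simp
  qed
qed

lemma sum_by_positions:
  assumes "a \<in> bounded_vectors k n d"
  shows "k * card (full_positions k n a) + (\<Sum>i\<in>interior_positions k n a. a i) = d"
proof (cases "k = 0")
  case True
  then show ?thesis using bounded_vectorsD[OF assms] by (auto simp: interior_positions_def)
next
  case False
  have "d = (\<Sum>i\<in>full_positions k n a \<union> interior_positions k n a. a i)"
    unfolding bounded_vectorsD(3)[OF assms, symmetric]
    using bounded_vectorsD(2)[OF assms] False
    by (intro sum.mono_neutral_right)
      (auto simp: full_positions_def interior_positions_def le_neq_implies_less)
  also have "\<dots> = (\<Sum>i\<in>full_positions k n a. a i) + (\<Sum>i\<in>interior_positions k n a. a i)"
    by (rule sum.union_disjoint) (auto simp: full_positions_def interior_positions_def)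
  also have "(\<Sum>i\<in>full_positions k n a. a i) = k * card (full_positions k n a)"
    by (simp add: full_positions_def)
  finally show ?thesis by simp
qed

section \<open>Bounding the shortage of transfers at the vertices\<close>

lemma twice_choose_two: "2 * int (n choose 2) = int n * (int n - 1)"
proof (cases n)
  case (Suc m)
  have "even (n * (n - 1))" by auto
  then have "2 * (n choose 2) = n * (n - 1)" by (simp add: choose_two)
  then have "int (2 * (n choose 2)) = int (n * (n - 1))" by (simp only:)
  then show ?thesis using Suc by (simp add: algebra_simps)
qed simp

text \<open>
  This bounds the total shortage of the vertices if \<open>d = q k\<close>: there are \<open>n choose q\<close> of them, each
  having \<open>q (n - q)\<close> transfers instead of \<open>2 (n - 1)\<close>. There is equality for \<open>q = 1, 2, n - 2, n - 1\<close>;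
  for \<open>3 \<le> q \<le> n - 3\<close> the weight is positive only for \<open>n = 6\<close>.
\<close>

lemma choose_lattice_vertex_weight_le:
  fixes n q :: nat
  assumes "n \<ge> 2" "q \<le> n"
  shows "int (n choose q) * (2 * (int n - 1) - int q * (int n - int q)) \<le> int n * (int n - 1)"
proof -
  consider "q = 0 \<or> q = n" | "q = 1 \<or> q = n - 1" | "q = 2 \<or> q = n - 2" "n \<ge> 4" | "n = 6" "q = 3"
    | "n \<ge> 7" "3 \<le> q" "q + 3 \<le> n"
    using assms by linarith
  then show ?thesis
  proof cases
    case 1
    then have eq: "int (n choose q) = 1" "int q * (int n - int q) = 0" by auto
    have "2 * (int n - 1) \<le> int n * (int n - 1)"
      using assms(1) by (intro mult_right_mono) auto
    then show ?thesis unfolding eq by simp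
  next
    case 2
    then have eq: "int (n choose q) = int n" "int q * (int n - int q) = int n - 1"
      using assms(1) binomial_symmetric[of 1 n] by (auto simp: of_nat_diff algebra_simps)
    show ?thesis unfolding eq by simp
  next
    case 3
    then have eq: "n choose q = n choose 2" "int q * (int n - int q) = 2 * (int n - 2)"
      using binomial_symmetric[of 2 n] by (auto simp: of_nat_diff algebra_simps)
    show ?thesis unfolding eq using twice_choose_two[of n] by (simp add: algebra_simps)
  next
    case 4
    then show ?thesis by (simp add: numeral_eq_Suc)
  next
    case 5
    have "0 \<le> (int q - 3) * (int n - 3 - int q)" using 5 by (intro mult_nonneg_nonneg) auto
    then have "2 * (int n - 1) - int q * (int n - int q) \<le> 0"
      using 5 by (simp add: algebra_simps)
    then have "int (n choose q) * (2 * (int n - 1) - int q * (int n - int q)) \<le> 0"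
      by (intro mult_nonneg_nonpos) auto
    moreover have "0 \<le> int n * (int n - 1)" using 5 by simp
    ultimately show ?thesis by linarith
  qed
qed

text \<open>
  This bounds the total shortage of the vertices if \<open>k\<close> does not divide \<open>d\<close>. With \<open>N = n - 1\<close> and
  \<open>q = d div k\<close>, a vertex has one coordinate strictly between \<open>0\<close> and \<open>k\<close>, and among the other \<open>N\<close>
  coordinates \<open>q\<close> are equal to \<open>k\<close>; it has \<open>q (N - q) + N\<close> transfers.
\<close>

lemma choose_vertex_weight_le:
  fixes N q :: nat
  assumes "N \<ge> 1" "q \<le> N"
  shows "int (N choose q) * (int N - int q * (int N - int q)) \<le> int N"
proof -
  consider "q = 0 \<or> q = N" | "q = 1 \<or> q = N - 1" | "N \<ge> 4" "2 \<le> q" "q + 2 \<le> N"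
    using assms by linarith
  then show ?thesis
  proof cases
    case 1
    then have eq: "int (N choose q) = 1" "int q * (int N - int q) = 0" by auto
    show ?thesis unfolding eq by simp
  next
    case 2
    then have eq: "int (N choose q) = int N" "int q * (int N - int q) = int N - 1"
      using assms(1) binomial_symmetric[of 1 N] by (auto simp: of_nat_diff algebra_simps)
    show ?thesis unfolding eq by simp
  next
    case 3
    have "0 \<le> (int q - 2) * (int N - 2 - int q)" using 3 by (intro mult_nonneg_nonneg) auto
    then have "int N - int q * (int N - int q) \<le> 0"
      using 3 by (simp add: algebra_simps)
    then have "int (N choose q) * (int N - int q * (int N - int q)) \<le> 0"
      by (intro mult_nonneg_nonpos) auto
    then show ?thesis by linarith
  qed
qed

lemma card_no_interior_le:
  assumes "k > 0"
  shows "card {a \<in> bounded_vectors k n (k * q). interior_positions k n a = {}} \<le> n choose q"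
proof -
  let ?V = "{a \<in> bounded_vectors k n (k * q). interior_positions k n a = {}}"
  have "card ?V \<le> card {Y. Y \<subseteq> {..<n} \<and> card Y = q}"
  proof (rule card_inj_on_le[of "full_positions k n"])
    show "inj_on (full_positions k n) ?V"
    proof (rule inj_onI)
      fix a b assume ab: "a \<in> ?V" "b \<in> ?V" "full_positions k n a = full_positions k n b"
      have val: "c i = (if i \<in> full_positions k n c then k else 0)" if "c \<in> ?V" "i < n" for c i
        using that bounded_vectorsD(2)[of c k n "k * q" i]
        by (auto simp: full_positions_def interior_positions_def)
      show "a = b"
      proof (rule bounded_vectors_eqI)
        show "a i = b i" if "i < n" for i
          using val[OF ab(1) that] val[OF ab(2) that] ab(3) by simp
      qed (use ab in auto)
    qed
    show "full_positions k n ` ?V \<subseteq> {Y. Y \<subseteq> {..<n} \<and> card Y = q}"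
    proof
      fix Y assume "Y \<in> full_positions k n ` ?V"
      then obtain a where a: "a \<in> ?V" "Y = full_positions k n a" by blast
      then show "Y \<in> {Y. Y \<subseteq> {..<n} \<and> card Y = q}"
        using sum_by_positions[of a k n "k * q"] assms by (auto simp: full_positions_def)
    qed
  qed auto
  then show ?thesis by (simp add: n_subsets)
qed

text \<open>
  Such a vector is determined by the position of its interior coordinate, whose value must be
  \<open>d mod k\<close>, and by the positions of the \<open>d div k\<close> coordinates equal to \<open>k\<close>.
\<close>

lemma card_one_interior_le:
  assumes "k > 0" "n > 0"
  shows "card {a \<in> bounded_vectors k n d. card (interior_positions k n a) = 1}
           \<le> n * ((n - 1) choose (d div k))"
proof -
  let ?V = "{a \<in> bounded_vectors k n d. card (interior_positions k n a) = 1}"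
  let ?W = "Sigma {..<n} (\<lambda>i. {Y. Y \<subseteq> {..<n} - {i} \<and> card Y = d div k})"
  define F where "F = (\<lambda>a. (the_elem (interior_positions k n a), full_positions k n a))"
  have struct: "\<exists>i. i < n \<and> interior_positions k n a = {i} \<and> a i = d mod k \<and>
                    card (full_positions k n a) = d div k" if a: "a \<in> ?V" for a
  proof -
    obtain i where i: "interior_positions k n a = {i}"
      using a by (auto simp: card_1_singleton_iff)
    then have "i < n" "a i < k" by (auto simp: interior_positions_def)
    moreover have d: "d = a i + k * card (full_positions k n a)"
      using sum_by_positions[of a k n d] a i by simp
    ultimately show ?thesis using i assms by (intro exI[of _ i]) simp
  qed
  have "card ?V \<le> card ?W"
  proof (rule card_inj_on_le[of F])
    show "inj_on F ?V"
    proof (rule inj_onI)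
      fix a b assume ab: "a \<in> ?V" "b \<in> ?V" "F a = F b"
      obtain i where i: "interior_positions k n a = {i}" "a i = d mod k" using struct[OF ab(1)] by blast
      obtain j where j: "interior_positions k n b = {j}" "b j = d mod k" using struct[OF ab(2)] by blast
      have eq: "j = i" "full_positions k n a = full_positions k n b"
        using ab(3) i j by (auto simp: F_def)
      have full: "c l = k" if "l \<in> full_positions k n c" for c l
        using that by (simp add: full_positions_def)
      have zero: "c l = 0" if "c \<in> ?V" "l < n" "l \<notin> full_positions k n c"
          "l \<notin> interior_positions k n c" for c l
        using that bounded_vectorsD(2)[of c k n d l]
        by (auto simp: full_positions_def interior_positions_def)
      have "a l = b l" if "l < n" for l
      proof (cases "l \<in> full_positions k n a")
        case True
        then show ?thesis using full[of l a] full[of l b] eq(2) by simp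
      next
        case False
        then show ?thesis
          using zero[OF ab(1) that] zero[OF ab(2) that] i j eq by (cases "l = i") auto
      qed
      then show "a = b"
        by (intro bounded_vectors_eqI[of a k n d b k d]) (use ab in auto)
    qed
    show "F ` ?V \<subseteq> ?W"
    proof
      fix Y assume "Y \<in> F ` ?V"
      then obtain a where a: "a \<in> ?V" "Y = F a" by blast
      from struct[OF a(1)] obtain i where i: "i < n" "interior_positions k n a = {i}"
        "card (full_positions k n a) = d div k" by blast
      have "i \<notin> full_positions k n a" "full_positions k n a \<subseteq> {..<n}"
        using i(2) by (auto simp: full_positions_def interior_positions_def)
      then show "Y \<in> ?W" using i a(2) by (auto simp: F_def)
    qed
    show "finite ?W" by (intro finite_SigmaI) auto
  qed
  also have "card ?W = (\<Sum>i<n. (n - 1) choose (d div k))"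
    by (subst card_SigmaI) (auto simp: n_subsets intro!: sum.cong)
  also have "\<dots> = n * ((n - 1) choose (d div k))" by simp
  finally show ?thesis .
qed

text \<open>
  Let \<open>w a\<close> be the excess of the number of transfers over \<open>2 (n - 1)\<close>. By \<open>card_transfer_pairs\<close> it equals
  \<open>t z + (m - 2) (n - 1)\<close>, which is nonnegative for \<open>m \<ge> 2\<close> and positive for \<open>m \<ge> 3\<close>. Reduction of
  the coordinate sum modulo \<open>k\<close> shows that only one of the cases \<open>m = 0\<close> and \<open>m = 1\<close> can occur,
  according to whether \<open>k\<close> divides \<open>d\<close>; there \<open>w\<close> is constant, and the number of such vectors was
  bounded above.
\<close>

lemma sum_transfer_pairs_ge:
  fixes k n d :: nat
  assumes k: "k > 0" and n: "n \<ge> 2"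
  shows "2 * (int n - 1) * int (card (bounded_vectors k n d)) + int (card
           {a \<in> bounded_vectors k n d. card (interior_positions k n a) \<ge> 3}) \<le>
         (\<Sum>a\<in>bounded_vectors k n d. int (card (transfer_pairs k n a))) + int n * (int n - 1)"
proof -
  let ?A = "bounded_vectors k n d"
  let ?m = "\<lambda>a. card (interior_positions k n a)" and ?t = "\<lambda>a. card (full_positions k n a)"
    and ?z = "\<lambda>a. card (zero_positions n a)"
  define w where "w = (\<lambda>a. int (card (transfer_pairs k n a)) - 2 * (int n - 1))"
  have w: "w a = int (?t a) * int (?z a) + (int (?m a) - 2) * (int n - 1)" if "a \<in> ?A" for a
  proof -
    have "int (card (transfer_pairs k n a)) = int (?t a) * int (?z a) + int (?m a) * int (n - 1)"
      unfolding card_transfer_pairs[OF that k] by simp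
    then show ?thesis using n by (simp add: w_def of_nat_diff algebra_simps)
  qed
  have z: "int (?z a) = int n - int (?t a) - int (?m a)" if "a \<in> ?A" for a
    using positions_partition[OF that k] by simp
  have w3: "w a \<ge> (if ?m a \<ge> 3 then 1 else 0)" if "a \<in> ?A" "?m a \<ge> 2" for a
  proof (cases "?m a \<ge> 3")
    case True
    have "1 * 1 \<le> (int (?m a) - 2) * (int n - 1)"
      using True n by (intro mult_mono) auto
    moreover have "0 \<le> int (?t a) * int (?z a)" by simp
    ultimately have "w a \<ge> 1" using w[OF that(1)] by linarith
    then show ?thesis by simp
  next
    case False
    then show ?thesis using that w[OF that(1)] by simp
  qed
  have small: "- (int n * (int n - 1)) \<le> sum w {a \<in> ?A. ?m a < 2}"
  proof (cases "k dvd d")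
    case True
    then obtain q where q: "d = k * q" by blast
    let ?V = "{a \<in> ?A. interior_positions k n a = {}}"
    have "?m a \<noteq> 1" if a: "a \<in> ?A" for a
    proof
      assume "?m a = 1"
      then obtain i where i: "interior_positions k n a = {i}" by (auto simp: card_1_singleton_iff)
      then have "0 < a i" "a i < k" by (auto simp: interior_positions_def)
      moreover have "d = k * ?t a + a i" using sum_by_positions[OF a] i by simp
      ultimately show False using True by (metis add_diff_cancel_left' dvd_diff_nat dvd_triv_left nat_dvd_not_less)
    qed
    then have V: "{a \<in> ?A. ?m a < 2} = ?V" by (auto simp: less_2_cases_iff)
    \<comment> \<open>The constant value of \<open>w\<close> on \<open>?V\<close>, where \<open>t = q\<close> and \<open>z = n - q\<close>.\<close>
    let ?c = "int q * (int n - int q) - 2 * (int n - 1)"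
    have tq: "?t a = q" if "a \<in> ?V" for a
      using sum_by_positions[of a k n d] that k q by auto
    have wV: "w a = ?c" if "a \<in> ?V" for a
      using w[of a] z[of a] tq[OF that] that by simp
    show ?thesis
    proof (cases "?V = {}")
      case True
      show ?thesis unfolding V True using n by simp
    next
      case False
      then obtain a where a: "a \<in> ?V" by blast
      then have qn: "q \<le> n" using positions_partition[of a k n d] tq[OF a] k by auto
      have "- (int n * (int n - 1)) \<le> int (card ?V) * ?c"
      proof (cases "?c \<ge> 0")
        case True
        then have "0 \<le> int (card ?V) * ?c" by simp
        moreover have "0 \<le> int n * (int n - 1)" using n by simp
        ultimately show ?thesis by linarith
      next
        case False
        have "card ?V \<le> n choose q" using card_no_interior_le[OF k, of n q] q by simp
        then have "int (card ?V) * (- ?c) \<le> int (n choose q) * (- ?c)"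
          using False by (intro mult_right_mono) auto
        also have "\<dots> \<le> int n * (int n - 1)"
          using choose_lattice_vertex_weight_le[OF n qn] by (simp add: algebra_simps)
        finally have "int (card ?V) * (- ?c) \<le> int n * (int n - 1)" by (simp only: UNIV_I)
        then show ?thesis unfolding mult_minus_right by linarith
      qed
      also have "\<dots> = sum w ?V" using wV by simp
      finally show ?thesis unfolding V .
    qed
  next
    case False
    let ?q = "d div k"
    let ?V = "{a \<in> ?A. ?m a = 1}"
    have "?m a \<noteq> 0" if a: "a \<in> ?A" for a
      using sum_by_positions[OF a] False by (auto simp: card_0_eq)
    then have V: "{a \<in> ?A. ?m a < 2} = ?V" by (auto simp: less_2_cases_iff)
    \<comment> \<open>The constant value of \<open>w\<close> on \<open>?V\<close>, where \<open>t = ?q\<close> and \<open>z = n - 1 - ?q\<close>.\<close>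
    let ?c = "int ?q * (int (n - 1) - int ?q) - int (n - 1)"
    have tq: "?t a = ?q" if "a \<in> ?V" for a
    proof -
      have "?m a = 1" using that by simp
      then obtain i where i: "interior_positions k n a = {i}" by (rule card_1_singletonE)
      then have "a i < k" by (auto simp: interior_positions_def)
      moreover have "d = a i + k * ?t a" using sum_by_positions[of a k n d] that i by simp
      ultimately show ?thesis by simp
    qed
    have wV: "w a = ?c" if "a \<in> ?V" for a
      using w[of a] z[of a] tq[OF that] that n by (simp add: of_nat_diff algebra_simps)
    show ?thesis
    proof (cases "?V = {}")
      case True
      show ?thesis unfolding V True using n by simp
    next
      case False
      then obtain a where a: "a \<in> ?V" by blast
      then have qn: "?q \<le> n - 1" using positions_partition[of a k n d] tq[OF a] k by auto
      have "- (int n * (int n - 1)) \<le> int (card ?V) * ?c"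
      proof (cases "?c \<ge> 0")
        case True
        then have "0 \<le> int (card ?V) * ?c" by simp
        moreover have "0 \<le> int n * (int n - 1)" using n by simp
        ultimately show ?thesis by linarith
      next
        case False
        have "card ?V \<le> n * ((n - 1) choose ?q)" using card_one_interior_le[OF k, of n d] n by simp
        then have "int (card ?V) * (- ?c) \<le> int (n * ((n - 1) choose ?q)) * (- ?c)"
          using False by (intro mult_right_mono) (auto simp only: of_nat_le_iff)
        also have "\<dots> = int n * (int ((n - 1) choose ?q) * (int (n - 1) - int ?q * (int (n - 1) - int ?q)))"
          by (simp add: algebra_simps)
        also have "\<dots> \<le> int n * int (n - 1)"
          using choose_vertex_weight_le[of "n - 1" ?q] n qn by (intro mult_left_mono) auto
        finally have "int (card ?V) * (- ?c) \<le> int n * int (n - 1)" by (simp only: UNIV_I)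
        moreover have "int n * int (n - 1) = int n * (int n - 1)" using n by (simp add: of_nat_diff)
        ultimately show ?thesis unfolding mult_minus_right by linarith
      qed
      also have "\<dots> = sum w ?V" using wV by simp
      finally show ?thesis unfolding V .
    qed
  qed
  have "int (card {a \<in> ?A. ?m a \<ge> 3}) = (\<Sum>a\<in>{a \<in> ?A. ?m a \<ge> 3}. 1)" by simp
  also have "\<dots> = (\<Sum>a\<in>{a \<in> ?A. \<not> ?m a < 2}. if ?m a \<ge> 3 then 1 else 0)"
    by (intro sum.mono_neutral_cong_left) auto
  also have "\<dots> \<le> sum w {a \<in> ?A. \<not> ?m a < 2}"
    using w3 by (intro sum_mono) auto
  finally have large: "int (card {a \<in> ?A. ?m a \<ge> 3}) \<le> sum w {a \<in> ?A. \<not> ?m a < 2}" .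
  have "sum w ?A = sum w {a \<in> ?A. ?m a < 2} + sum w {a \<in> ?A. \<not> ?m a < 2}"
    by (subst sum.union_disjoint[symmetric]) (auto intro!: sum.cong)
  moreover have "sum w ?A = (\<Sum>a\<in>?A. int (card (transfer_pairs k n a))) - 2 * (int n - 1) * int (card ?A)"
    by (simp add: w_def sum_subtractf)
  ultimately show ?thesis using small large by linarith
qed

section \<open>The Freiman equation for slices of a cube\<close>

text \<open>
  The two bounds on the number of transfers combine to the weak inequality. Strictness comes for
  \<open>n \<ge> 4\<close> from a vector of the doubled slice with odd coordinates exactly \<open>0, 1, 2, 3\<close>, and for
  \<open>n = 3\<close> from an interior point of the slice.
\<close>

theorem card_bounded_vectors_double_greater:
  assumes k: "k > 0" and n: "n \<ge> 3"
    and d: "if n = 3 then 3 \<le> d \<and> d \<le> 3 * k - 3 else 2 \<le> d \<and> d + 2 \<le> k * n"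
  shows "int (card (bounded_vectors (2 * k) n (2 * d))) >
           int n * int (card (bounded_vectors k n d)) - int (n choose 2)"
proof -
  let ?A = "bounded_vectors k n d" and ?B = "bounded_vectors (2 * k) n (2 * d)"
  let ?S2 = "{s \<in> ?B. card (odd_positions s) = 2}" and ?S4 = "{s \<in> ?B. card (odd_positions s) = 4}"
  let ?I = "{a \<in> ?A. card (interior_positions k n a) \<ge> 3}"
  have ch: "2 * int (n choose 2) = int n * (int n - 1)" by (rule twice_choose_two)
  have le: "int (card ?A) + int (card ?S2) + int (card ?S4) \<le> int (card ?B)"
    using card_bounded_vectors_double_ge[of k n d] by linarith
  have T: "(\<Sum>a\<in>?A. int (card (transfer_pairs k n a))) \<le> 2 * int (card ?S2)"
    using sum_transfer_pairs_le[of k n d] by (simp flip: of_nat_sum)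
  have ge: "2 * (int n - 1) * int (card ?A) + int (card ?I) \<le>
         (\<Sum>a\<in>?A. int (card (transfer_pairs k n a))) + int n * (int n - 1)"
    using sum_transfer_pairs_ge[OF k, of n d] n by simp
  have extra: "int (card ?I) + 2 * int (card ?S4) > 0"
  proof (cases "n = 3")
    case True
    then have d3: "3 \<le> d" "d \<le> 3 * k - 3" using d by auto
    then have "d - 3 \<le> (\<Sum>i<3::nat. k - 2)" by simp
    from sum_below_bounds_ex[OF this] obtain c :: "nat \<Rightarrow> nat" where
      c': "(\<forall>i. c i \<le> k - 2) \<and> (\<forall>i\<ge>3. c i = 0) \<and> (\<Sum>i<3. c i) = d - 3" ..
    then have c: "\<And>i. c i \<le> k - 2" "\<And>i. i \<ge> 3 \<Longrightarrow> c i = 0" "(\<Sum>i<3. c i) = d - 3"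
      by simp_all
    let ?a = "\<lambda>i. if i < 3 then Suc (c i) else 0"
    have k2: "k \<ge> 2" using d3 by simp
    have "?a \<in> ?A"
    proof (rule bounded_vectorsI)
      show "?a i \<le> k" for i using c(1)[of i] k2 by (cases "i < 3") auto
      have "(\<Sum>i<n. ?a i) = (\<Sum>i<3::nat. c i + 1)" using True by (intro sum.cong) auto
      also have "\<dots> = d" using c(3) d3 by (subst sum.distrib) simp
      finally show "(\<Sum>i<n. ?a i) = d" .
    qed (use True in auto)
    moreover have "interior_positions k n ?a = {..<3}"
    proof -
      have "Suc (c i) < k" for i using c(1)[of i] k2 by linarith
      then show ?thesis using True by (auto simp: interior_positions_def)
    qed
    ultimately have "?a \<in> ?I" by simp
    then have "card ?I > 0" by (auto simp: card_gt_0_iff)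
    then show ?thesis by simp
  next
    case False
    then have n4: "n \<ge> 4" and d2: "2 \<le> d" "d + 2 \<le> k * n" using n d by auto
    \<comment> \<open>Take \<open>s = 2 c + 1\<close> on the first four coordinates and \<open>s = 2 c\<close> elsewhere; then \<open>c < k\<close> is needed on those four.\<close>
    let ?u = "\<lambda>i::nat. if i < 4 then k - 1 else k"
    have "(\<Sum>i<n. ?u i) + 4 = k * n"
    proof -
      have "(\<Sum>i<n. ?u i + of_bool (i < 4)) = (\<Sum>i<n. k)"
        using k by (intro sum.cong) auto
      then have "k * n = (\<Sum>i<n. ?u i + of_bool (i < 4))" by simp
      also have "\<dots> = (\<Sum>i<n. ?u i) + (\<Sum>i<n. of_bool (i < 4))" by (rule sum.distrib)
      also have "(\<Sum>i<n. of_bool (i < 4)) = (\<Sum>i<4::nat. 1::nat)"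
        using n4 by (intro sum.mono_neutral_cong_right) auto
      finally show ?thesis by simp
    qed
    then have "d - 2 \<le> (\<Sum>i<n. ?u i)" using d2 by linarith
    from sum_below_bounds_ex[OF this] obtain c :: "nat \<Rightarrow> nat" where
      c': "(\<forall>i. c i \<le> ?u i) \<and> (\<forall>i\<ge>n. c i = 0) \<and> (\<Sum>i<n. c i) = d - 2" ..
    then have c: "\<And>i. c i \<le> ?u i" "\<And>i. i \<ge> n \<Longrightarrow> c i = 0" "(\<Sum>i<n. c i) = d - 2"
      by simp_all
    let ?s = "\<lambda>i. 2 * c i + of_bool (i < 4)"
    have "?s \<in> ?B"
    proof (rule bounded_vectorsI)
      show "?s i \<le> 2 * k" for i using c(1)[of i] k by (auto split: if_splits)
      show "?s i = 0" if "i \<ge> n" for i using c(2)[OF that] n4 that by simp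
      have "(\<Sum>i<n. ?s i) = 2 * (d - 2) + (\<Sum>i<n. of_bool (i < 4))"
        by (simp add: sum.distrib c(3) flip: sum_distrib_left)
      also have "(\<Sum>i<n. of_bool (i < 4)) = (\<Sum>i<4::nat. 1::nat)"
        using n4 by (intro sum.mono_neutral_cong_right) auto
      finally show "(\<Sum>i<n. ?s i) = 2 * d" using d2 by simp
    qed
    moreover have "odd_positions ?s = {..<4}" by (auto simp: odd_positions_def)
    ultimately have "?s \<in> ?S4" by simp
    then have "card ?S4 > 0" by (auto simp: card_gt_0_iff)
    then show ?thesis by simp
  qed
  show ?thesis
    using le T ge extra ch by (simp add: algebra_simps)
qed

lemma bounded_vectors_complement:
  assumes "d \<le> k * n"
  shows "card (bounded_vectors k n (k * n - d)) = card (bounded_vectors k n d)"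
proof -
  let ?c = "\<lambda>b i. if i < n then k - b i else (0::nat)"
  have sub: "?c b \<in> bounded_vectors k n (k * n - e)" if b: "b \<in> bounded_vectors k n e" for b e
  proof (rule bounded_vectorsI)
    have "(\<Sum>i<n. ?c b i) = (\<Sum>i<n. k) - (\<Sum>i<n. b i)"
      using bounded_vectorsD(2)[OF b] by (subst sum_subtractf_nat[symmetric]) (auto intro!: sum.cong)
    then show "(\<Sum>i<n. ?c b i) = k * n - e" using bounded_vectorsD(3)[OF b] by (simp add: mult.commute)
  qed auto
  have inv: "?c (?c b) = b" if b: "b \<in> bounded_vectors k n e" for b e
    using bounded_vectorsD(1,2)[OF b] by (auto simp: fun_eq_iff)
  have dd: "k * n - (k * n - d) = d" using assms by simp
  have "bij_betw ?c (bounded_vectors k n (k * n - d)) (bounded_vectors k n d)"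
  proof (rule bij_betw_byWitness[where f' = ?c])
    show "?c ` bounded_vectors k n (k * n - d) \<subseteq> bounded_vectors k n d"
      using sub[of _ "k * n - d"] unfolding dd by blast
    show "?c ` bounded_vectors k n d \<subseteq> bounded_vectors k n (k * n - d)" using sub by blast
  qed (use inv in blast)+
  then show ?thesis by (rule bij_betw_same_card)
qed

text \<open>
  For \<open>e \<le> k\<close> the upper bounds on the coordinates follow from the value of the sum, so this is the
  number of all compositions of \<open>e\<close> into \<open>n\<close> nonnegative parts.
\<close>

lemma card_bounded_vectors:
  assumes "e \<le> k"
  shows "card (bounded_vectors k n e) = (e + n - 1) choose e"
proof -
  let ?L = "{l :: nat list. length l = n \<and> sum_list l = e}"
  have "bij_betw (\<lambda>b. map b [0..<n]) (bounded_vectors k n e) ?L"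
  proof (rule bij_betw_byWitness[where f' = "\<lambda>l i. if i < n then l ! i else 0"])
    show "\<forall>b\<in>bounded_vectors k n e. (\<lambda>i. if i < n then map b [0..<n] ! i else 0) = b"
      by (auto simp: fun_eq_iff bounded_vectors_def)
    show "\<forall>l\<in>?L. map (\<lambda>i. if i < n then l ! i else 0) [0..<n] = l"
      by (auto intro!: nth_equalityI)
    show "(\<lambda>b. map b [0..<n]) ` bounded_vectors k n e \<subseteq> ?L"
      by (auto simp: bounded_vectors_def sum_list_sum_nth lessThan_atLeast0)
    show "(\<lambda>l i. if i < n then l ! i else 0) ` ?L \<subseteq> bounded_vectors k n e"
    proof
      fix b assume "b \<in> (\<lambda>l i. if i < n then l ! i else 0) ` ?L"
      then obtain l where l: "length l = n" "sum_list l = e" "b = (\<lambda>i. if i < n then l ! i else 0)"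
        by auto
      show "b \<in> bounded_vectors k n e"
      proof (rule bounded_vectorsI)
        show "b i \<le> k" if "i < n" for i
          using that l assms member_le_sum_list[of "l ! i" l] by (auto intro: order_trans)
        show "(\<Sum>i<n. b i) = e" using l by (simp add: sum_list_sum_nth lessThan_atLeast0)
      qed (use l in auto)
    qed
  qed
  then have "card (bounded_vectors k n e) = card ?L" by (rule bij_betw_same_card)
  then show ?thesis by (simp add: card_length_sum_list)
qed

text \<open>
  Here \<open>n = 1\<close> cannot occur, \<open>n = 2\<close> always satisfies the right-hand side, and for \<open>n \<ge> 3\<close> the
  values of \<open>d\<close> outside the list are exactly those for which the inequality is strict.
\<close>

theorem card_bounded_vectors_double_eq_iff:
  fixes k n d :: nat
  assumes k: "k \<ge> 3" and kd: "k \<le> d" and dn: "d < k * n"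
  shows "int (card (bounded_vectors (2 * k) n (2 * d))) =
           int n * int (card (bounded_vectors k n d)) - int (n choose 2) \<longleftrightarrow>
    (n = 2 \<and> d \<in> {k..2 * k - 1}) \<or>
    (n = 3 \<and> (d = 3 * k - 2 \<or> d = 3 * k - 1)) \<or>
    (n \<ge> 4 \<and> d = k * n - 1)" (is "?E \<longleftrightarrow> ?C")
proof
  assume C: ?C
  define e where "e = k * n - d"
  have e: "n \<ge> 2" "1 \<le> e" "e \<le> k" "n = 2 \<or> e = 1 \<or> n = 3 \<and> e = 2"
    using C k kd dn by (auto simp: e_def algebra_simps)
  have f: "card (bounded_vectors k n d) = (e + n - 1) choose e"
    using bounded_vectors_complement[of d k n] card_bounded_vectors[OF e(3), of n] dn by (simp add: e_def)
  have "card (bounded_vectors (2 * k) n (2 * k * n - 2 * d)) = card (bounded_vectors (2 * k) n (2 * d))"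
    by (rule bounded_vectors_complement) (use dn in simp)
  moreover have "2 * k * n - 2 * d = 2 * e" by (simp add: e_def algebra_simps)
  ultimately have g: "card (bounded_vectors (2 * k) n (2 * d)) = (2 * e + n - 1) choose (2 * e)"
    using card_bounded_vectors[of "2 * e" "2 * k" n] e(3) by simp
  consider "n = 2" | "e = 1" | "n = 3" "e = 2" using e by blast
  then show ?E
  proof cases
    case 1
    then show ?thesis unfolding f g by simp
  next
    case 2
    have "(Suc n choose 2) = n + (n choose 2)"
      by (simp add: numeral_2_eq_2)
    moreover note twice_choose_two[of n]
    moreover have "(e + n - 1) choose e = n" "(2 * e + n - 1) choose (2 * e) = Suc n choose 2"
      using 2 e(1) by (auto simp: numeral_2_eq_2)
    ultimately show ?thesis unfolding f g by (simp add: algebra_simps)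
  next
    case 3
    then show ?thesis unfolding f g by (simp add: numeral_eq_Suc)
  qed
next
  assume E: ?E
  show ?C
  proof (rule ccontr)
    assume C: "\<not> ?C"
    have n: "n \<ge> 3"
    proof (rule ccontr)
      assume "\<not> n \<ge> 3"
      then consider "n = 0" | "n = 1" | "n = 2" by linarith
      then show False
      proof cases
        case 3
        then have "d \<in> {k..2 * k - 1}" using kd dn by simp
        then show False using C 3 by blast
      qed (use kd dn in auto)
    qed
    have "if n = 3 then 3 \<le> d \<and> d \<le> 3 * k - 3 else 2 \<le> d \<and> d + 2 \<le> k * n"
    proof (cases "n = 3")
      case True
      then have "d \<noteq> 3 * k - 2" "d \<noteq> 3 * k - 1" using C by blast+
      moreover have "d < 3 * k" using dn True by simp
      ultimately have "d \<le> 3 * k - 3" by linarith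
      moreover have "3 \<le> d" using k kd by linarith
      ultimately show ?thesis using True by simp
    next
      case False
      then have "n \<ge> 4" using n by linarith
      then have "d \<noteq> k * n - 1" using C by blast
      then have "d + 2 \<le> k * n" using dn by linarith
      moreover have "2 \<le> d" using k kd by linarith
      ultimately show ?thesis using False by simp
    qed
    moreover have "k > 0" using k by simp
    ultimately have "int (card (bounded_vectors (2 * k) n (2 * d))) >
        int n * int (card (bounded_vectors k n d)) - int (n choose 2)"
      by (intro card_bounded_vectors_double_greater[OF _ n])
    then show False using E by linarith
  qed
qed

section \<open>Subrings of a commutative ring type and their ideals\<close>

abbreviation ring_on :: "'b::comm_ring_1 set \<Rightarrow> 'b ring" where
  "ring_on R \<equiv> ring_of_type_algebra\<lparr>carrier := R\<rparr>"

lemma ring_of_type_algebra_simps [simp]: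
  "x \<otimes>\<^bsub>ring_of_type_algebra\<^esub> y = x * y"
  "x \<oplus>\<^bsub>ring_of_type_algebra\<^esub> y = x + y"
  "\<zero>\<^bsub>ring_of_type_algebra\<^esub> = 0"
  "\<one>\<^bsub>ring_of_type_algebra\<^esub> = 1"
  by (simp_all add: ring_of_type_algebra_def)

definition is_subring :: "'b::comm_ring_1 set \<Rightarrow> bool" where
  "is_subring R \<longleftrightarrow> 1 \<in> R \<and> (\<forall>x\<in>R. \<forall>y\<in>R. x + y \<in> R \<and> x * y \<in> R) \<and> (\<forall>x\<in>R. - x \<in> R)"

lemma is_subringD:
  assumes "is_subring R"
  shows "0 \<in> R" "1 \<in> R" "x \<in> R \<Longrightarrow> - x \<in> R"
    "x \<in> R \<Longrightarrow> y \<in> R \<Longrightarrow> x + y \<in> R" "x \<in> R \<Longrightarrow> y \<in> R \<Longrightarrow> x * y \<in> R"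
proof -
  have "1 + - 1 \<in> R" using assms unfolding is_subring_def by blast
  then show "0 \<in> R" by simp
qed (use assms in \<open>auto simp: is_subring_def\<close>)

lemma cring_ring_on:
  assumes "is_subring R"
  shows "cring (ring_on R)"
proof (rule cringI)
  note D = is_subringD[OF assms]
  show "abelian_group (ring_on R)"
  proof (rule abelian_groupI)
    fix x assume "x \<in> carrier (ring_on R)"
    then show "\<exists>y\<in>carrier (ring_on R). y \<oplus>\<^bsub>ring_on R\<^esub> x = \<zero>\<^bsub>ring_on R\<^esub>"
      using D(3) by (intro bexI[of _ "- x"]) auto
  qed (use D in \<open>auto simp: algebra_simps\<close>)
  show "Group.comm_monoid (ring_on R)"
    by (rule comm_monoidI) (use D in \<open>auto simp: algebra_simps\<close>)
qed (auto simp: algebra_simps)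

lemma ring_ring_on:
  assumes "is_subring R"
  shows "ring (ring_on R)"
  using cring_ring_on[OF assms] by (rule cring.axioms)

lemma ideal_ring_onI:
  assumes R: "is_subring R" and "I \<subseteq> R" "0 \<in> I"
    and add: "\<And>x y. x \<in> I \<Longrightarrow> y \<in> I \<Longrightarrow> x + y \<in> I"
    and mult: "\<And>x y. x \<in> R \<Longrightarrow> y \<in> I \<Longrightarrow> x * y \<in> I"
  shows "ideal I (ring_on R)"
proof (rule idealI)
  interpret ring "ring_on R" by (rule ring_ring_on[OF R])
  have neg: "- x \<in> I" if "x \<in> I" for x
    using mult[of "- 1" x] is_subringD[OF R] that by simp
  show "subgroup I (add_monoid (ring_on R))"
  proof (rule add.subgroupI)
    fix a assume a: "a \<in> I"
    have "\<ominus>\<^bsub>ring_on R\<^esub> a = - a"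
      by (rule minus_equality) (use a neg assms(2) in auto)
    then show "\<ominus>\<^bsub>ring_on R\<^esub> a \<in> I" using neg[OF a] by simp
  qed (use assms in auto)
next
  fix a x assume "a \<in> I" "x \<in> carrier (ring_on R)"
  then have "x * a \<in> I" using mult by simp
  then show "x \<otimes>\<^bsub>ring_on R\<^esub> a \<in> I" "a \<otimes>\<^bsub>ring_on R\<^esub> x \<in> I"
    by (simp_all add: mult.commute)
qed (rule ring_ring_on[OF R])

lemma ideal_ring_onD:
  assumes "ideal I (ring_on R)"
  shows "I \<subseteq> R" "0 \<in> I" "x \<in> I \<Longrightarrow> y \<in> I \<Longrightarrow> x + y \<in> I" "x \<in> R \<Longrightarrow> y \<in> I \<Longrightarrow> x * y \<in> I"
    "x \<in> I \<Longrightarrow> y \<in> R \<Longrightarrow> x * y \<in> I" "finite A \<Longrightarrow> (\<And>a. a \<in> A \<Longrightarrow> f a \<in> I) \<Longrightarrow> sum f A \<in> I"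
proof -
  interpret ideal I "ring_on R" by fact
  show "I \<subseteq> R" using a_subset by simp
  show zero: "0 \<in> I" using additive_subgroup.zero_closed[OF is_additive_subgroup] by simp
  show add: "x + y \<in> I" if "x \<in> I" "y \<in> I" for x y
    using additive_subgroup.a_closed[OF is_additive_subgroup that] by simp
  show "x * y \<in> I" if "x \<in> R" "y \<in> I" using I_l_closed[of y x] that by simp
  show "x * y \<in> I" if "x \<in> I" "y \<in> R" using I_r_closed[of x y] that by simp
  show "sum f A \<in> I" if "finite A" "\<And>a. a \<in> A \<Longrightarrow> f a \<in> I"
    using that by (induction A rule: finite_induct) (auto intro: zero add)
qed

lemma primeideal_ring_on_iff:
  assumes "is_subring R"
  shows "primeideal P (ring_on R) \<longleftrightarrow>
           ideal P (ring_on R) \<and> 1 \<notin> P \<and> (\<forall>x\<in>R. \<forall>y\<in>R. x * y \<in> P \<longrightarrow> x \<in> P \<or> y \<in> P)"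
proof
  assume "primeideal P (ring_on R)"
  then interpret primeideal P "ring_on R" .
  have id: "ideal P (ring_on R)" by (rule is_ideal)
  have "1 \<notin> P"
  proof
    assume "1 \<in> P"
    then have "R \<subseteq> P" using ideal_ring_onD(4)[OF id, of _ 1] by auto
    then show False using ideal_ring_onD(1)[OF id] I_notcarr by auto
  qed
  then show "ideal P (ring_on R) \<and> 1 \<notin> P \<and> (\<forall>x\<in>R. \<forall>y\<in>R. x * y \<in> P \<longrightarrow> x \<in> P \<or> y \<in> P)"
    using id I_prime by simp
next
  assume *: "ideal P (ring_on R) \<and> 1 \<notin> P \<and> (\<forall>x\<in>R. \<forall>y\<in>R. x * y \<in> P \<longrightarrow> x \<in> P \<or> y \<in> P)"
  show "primeideal P (ring_on R)"
    by (rule primeidealI) (use * is_subringD[OF assms] cring_ring_on[OF assms] in auto)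
qed

section \<open>Monomial ideals\<close>

definition mpol_carrier :: "nat \<Rightarrow> 'a::field mpol set" where
  "mpol_carrier n = {p. \<forall>b\<in>Poly_Mapping.keys p. Poly_Mapping.keys b \<subseteq> {..<n}}"

lemma mpol_ring_eq: "mpol_ring n = ring_on (mpol_carrier n)"
  by (simp add: mpol_ring_def mpol_carrier_def)

lemma keys_add_nat: "Poly_Mapping.keys (b + c) = Poly_Mapping.keys b \<union> Poly_Mapping.keys (c :: nat \<Rightarrow>\<^sub>0 nat)"
  by (auto simp: in_keys_iff lookup_add)

lemma keys_multE:
  assumes "b \<in> Poly_Mapping.keys (p * q)"
  obtains u v where "u \<in> Poly_Mapping.keys p" "v \<in> Poly_Mapping.keys q" "b = u + v"
  using assms keys_mult[of p q] by blast

lemma keys_addE: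
  assumes "b \<in> Poly_Mapping.keys (p + q)"
  obtains "b \<in> Poly_Mapping.keys p" | "b \<in> Poly_Mapping.keys q"
  using assms Poly_Mapping.keys_add[of p q] by blast

lemma keys_uminus: "Poly_Mapping.keys (- p) = Poly_Mapping.keys (p :: 'a::field mpol)"
  by (auto simp: in_keys_iff)

lemma is_subring_mpol_carrier [simp]: "is_subring (mpol_carrier n)"
  unfolding is_subring_def mpol_carrier_def
  by (auto simp: keys_uminus keys_add_nat elim!: keys_multE keys_addE)

lemma mpol_sum_monomials:
  "p = (\<Sum>b\<in>Poly_Mapping.keys p. Poly_Mapping.single b (Poly_Mapping.lookup p b))"
proof (rule poly_mapping_eqI)
  fix k
  show "Poly_Mapping.lookup p k =
    Poly_Mapping.lookup (\<Sum>b\<in>Poly_Mapping.keys p. Poly_Mapping.single b (Poly_Mapping.lookup p b)) k"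
    by (simp add: lookup_sum lookup_single when_def in_keys_iff)
qed

lemma lookup_mult_sum:
  fixes p q :: "'a::field mpol"
  shows "Poly_Mapping.lookup (p * q) b =
    (\<Sum>u\<in>Poly_Mapping.keys p. \<Sum>v\<in>Poly_Mapping.keys q.
       if u + v = b then Poly_Mapping.lookup p u * Poly_Mapping.lookup q v else 0)"
proof -
  have "p * q = (\<Sum>u\<in>Poly_Mapping.keys p. Poly_Mapping.single u (Poly_Mapping.lookup p u)) *
                (\<Sum>v\<in>Poly_Mapping.keys q. Poly_Mapping.single v (Poly_Mapping.lookup q v))"
    using mpol_sum_monomials[of p] mpol_sum_monomials[of q] by simp
  also have "\<dots> = (\<Sum>u\<in>Poly_Mapping.keys p. \<Sum>v\<in>Poly_Mapping.keys q.
       Poly_Mapping.single (u + v) (Poly_Mapping.lookup p u * Poly_Mapping.lookup q v))"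
    by (simp add: sum_product mult_single)
  finally show ?thesis by (simp add: lookup_sum lookup_single when_def)
qed

lemma lookup_const_mult:
  "Poly_Mapping.lookup (Poly_Mapping.single 0 c * p) b = c * Poly_Mapping.lookup (p :: 'a::field mpol) b"
  by (simp flip: mult_map_scale_conv_mult add: Poly_Mapping.map.rep_eq when_def)

definition monomial_ideal :: "nat \<Rightarrow> (nat \<Rightarrow>\<^sub>0 nat) set \<Rightarrow> 'a::field mpol set" where
  "monomial_ideal n B = {p \<in> mpol_carrier n. \<forall>b\<in>Poly_Mapping.keys p. \<exists>c\<in>B. \<exists>u. b = c + u}"

lemma ideal_monomial_ideal: "ideal (monomial_ideal n B) (mpol_ring n :: 'a::field mpol ring)"
  unfolding mpol_ring_eq
proof (rule ideal_ring_onI)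
  let ?S = "mpol_carrier n :: 'a mpol set"
  note D = is_subringD[OF is_subring_mpol_carrier[of n, where ?'a = 'a]]
  show "monomial_ideal n B \<subseteq> ?S" "(0 :: 'a mpol) \<in> monomial_ideal n B"
    using D by (auto simp: monomial_ideal_def)
  show "x + y \<in> monomial_ideal n B" if "x \<in> monomial_ideal n B" "y \<in> monomial_ideal n B" for x y :: "'a mpol"
    using that D by (auto simp: monomial_ideal_def elim!: keys_addE)
  show "x * y \<in> monomial_ideal n B" if "x \<in> ?S" "y \<in> monomial_ideal n B" for x y :: "'a mpol"
  proof -
    have "\<exists>c\<in>B. \<exists>w. b = c + w" if b: "b \<in> Poly_Mapping.keys (x * y)" for b
    proof -
      from b obtain u v where uv: "v \<in> Poly_Mapping.keys y" "b = u + v" by (rule keys_multE)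
      with \<open>y \<in> monomial_ideal n B\<close> obtain c w where "c \<in> B" "v = c + w"
        by (auto simp: monomial_ideal_def)
      with uv have "c \<in> B" "b = c + (w + u)" by (simp_all add: ac_simps)
      then show ?thesis by blast
    qed
    then show ?thesis using that D by (auto simp: monomial_ideal_def)
  qed
qed simp

lemma monomial_in_monomial_ideal:
  assumes "b \<in> B" "Poly_Mapping.keys b \<subseteq> {..<n}"
  shows "monomial b \<in> monomial_ideal n B"
  using assms by (auto simp: monomial_ideal_def monomial_def mpol_carrier_def intro!: bexI[of _ b] exI[of _ 0])

text \<open>
  A polynomial is the sum of its terms, and a term whose exponent exceeds some \<open>c \<in> B\<close> is a multiple of
  \<open>monomial c\<close>.
\<close>

lemma genideal_monomials:
  assumes B: "\<And>b. b \<in> B \<Longrightarrow> Poly_Mapping.keys b \<subseteq> {..<n}"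
  shows "Idl\<^bsub>mpol_ring n\<^esub> (monomial ` B) = (monomial_ideal n B :: 'a::field mpol set)"
proof
  let ?S = "mpol_carrier n :: 'a mpol set"
  interpret ring "mpol_ring n :: 'a mpol ring"
    unfolding mpol_ring_eq by (rule ring_ring_on) simp
  show "Idl\<^bsub>mpol_ring n\<^esub> (monomial ` B) \<subseteq> (monomial_ideal n B :: 'a mpol set)"
    by (rule genideal_minimal[OF ideal_monomial_ideal])
      (use B monomial_in_monomial_ideal in blast)
  have sub: "monomial ` B \<subseteq> carrier (mpol_ring n :: 'a mpol ring)"
    using B by (intro image_subsetI) (simp add: mpol_ring_eq monomial_def mpol_carrier_def)
  have id: "ideal (Idl\<^bsub>mpol_ring n\<^esub> (monomial ` B)) (ring_on ?S)"
    using genideal_ideal[OF sub] by (simp add: mpol_ring_eq)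
  show "(monomial_ideal n B :: 'a mpol set) \<subseteq> Idl\<^bsub>mpol_ring n\<^esub> (monomial ` B)"
  proof
    fix p :: "'a mpol" assume p: "p \<in> monomial_ideal n B"
    have "Poly_Mapping.single b (Poly_Mapping.lookup p b) \<in> Idl\<^bsub>mpol_ring n\<^esub> (monomial ` B)"
      if b: "b \<in> Poly_Mapping.keys p" for b
    proof -
      obtain c u where cu: "c \<in> B" "b = c + u" using p b by (auto simp: monomial_ideal_def)
      have "Poly_Mapping.keys b \<subseteq> {..<n}" using p b by (auto simp: monomial_ideal_def mpol_carrier_def)
      then have "Poly_Mapping.single u (Poly_Mapping.lookup p b) \<in> ?S"
        by (auto simp: mpol_carrier_def cu keys_add_nat)
      moreover have "monomial c \<in> Idl\<^bsub>mpol_ring n\<^esub> (monomial ` B :: 'a mpol set)"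
        using genideal_self[OF sub] cu by blast
      ultimately have "Poly_Mapping.single u (Poly_Mapping.lookup p b) * monomial c
                          \<in> Idl\<^bsub>mpol_ring n\<^esub> (monomial ` B)"
        by (rule ideal_ring_onD(4)[OF id])
      then show ?thesis by (simp add: monomial_def mult_single cu add.commute)
    qed
    then have "(\<Sum>b\<in>Poly_Mapping.keys p. Poly_Mapping.single b (Poly_Mapping.lookup p b))
                 \<in> Idl\<^bsub>mpol_ring n\<^esub> (monomial ` B)"
      by (intro ideal_ring_onD(6)[OF id]) auto
    then show "p \<in> Idl\<^bsub>mpol_ring n\<^esub> (monomial ` B)" by (simp flip: mpol_sum_monomials)
  qed
qed

definition exponent_sums :: "(nat \<Rightarrow>\<^sub>0 nat) set \<Rightarrow> (nat \<Rightarrow>\<^sub>0 nat) set \<Rightarrow> (nat \<Rightarrow>\<^sub>0 nat) set" where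
  "exponent_sums B C = {b + c |b c. b \<in> B \<and> c \<in> C}"

lemma ideal_prod_monomial_ideal:
  assumes B: "\<And>b. b \<in> B \<Longrightarrow> Poly_Mapping.keys b \<subseteq> {..<n}"
    and C: "\<And>c. c \<in> C \<Longrightarrow> Poly_Mapping.keys c \<subseteq> {..<n}"
  shows "ideal_prod (mpol_ring n) (monomial_ideal n B) (monomial_ideal n C) =
           (monomial_ideal n (exponent_sums B C) :: 'a::field mpol set)"
proof
  let ?S = "mpol_carrier n :: 'a mpol set" and ?M = "monomial_ideal n (exponent_sums B C) :: 'a mpol set"
  let ?P = "ideal_prod (mpol_ring n) (monomial_ideal n B) (monomial_ideal n C) :: 'a mpol set"
  interpret ring "mpol_ring n :: 'a mpol ring"
    unfolding mpol_ring_eq by (rule ring_ring_on) simp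
  have idM: "ideal ?M (ring_on ?S)" using ideal_monomial_ideal by (simp add: mpol_ring_eq)
  show "?P \<subseteq> ?M"
  proof
    fix x assume "x \<in> ?P"
    then show "x \<in> ?M"
    proof (induction rule: ideal_prod.induct)
      case (prod p q)
      have "\<exists>c\<in>exponent_sums B C. \<exists>w. b = c + w" if b: "b \<in> Poly_Mapping.keys (p * q)" for b
      proof -
        from b obtain u v where uv: "u \<in> Poly_Mapping.keys p" "v \<in> Poly_Mapping.keys q" "b = u + v"
          by (rule keys_multE)
        obtain c w where c: "c \<in> B" "u = c + w" using uv prod by (auto simp: monomial_ideal_def)
        obtain c' w' where c': "c' \<in> C" "v = c' + w'" using uv prod by (auto simp: monomial_ideal_def)
        have "c + c' \<in> exponent_sums B C" "b = (c + c') + (w + w')"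
          using c c' uv by (auto simp: exponent_sums_def ac_simps)
        then show ?thesis by blast
      qed
      then show ?case
        using prod is_subringD(5)[OF is_subring_mpol_carrier[of n, where ?'a = 'a], of p q]
        by (auto simp: monomial_ideal_def mpol_ring_eq)
    next
      case (sum s1 s2)
      then show ?case using ideal_ring_onD(3)[OF idM] by (simp add: mpol_ring_eq)
    qed
  qed
  have idP: "ideal ?P (mpol_ring n)"
    by (intro ideal_prod_is_ideal ideal_monomial_ideal)
  have "?M = Idl\<^bsub>mpol_ring n\<^esub> (monomial ` exponent_sums B C)"
  proof (rule genideal_monomials[symmetric])
    fix x assume "x \<in> exponent_sums B C"
    then obtain b c where "b \<in> B" "c \<in> C" "x = b + c" by (auto simp: exponent_sums_def)
    then show "Poly_Mapping.keys x \<subseteq> {..<n}" using B[of b] C[of c] by (simp add: keys_add_nat)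
  qed
  also have "\<dots> \<subseteq> ?P"
  proof (rule genideal_minimal[OF idP], rule image_subsetI)
    fix x assume "x \<in> exponent_sums B C"
    then obtain b c where bc: "b \<in> B" "c \<in> C" "x = b + c" by (auto simp: exponent_sums_def)
    have "monomial b \<otimes>\<^bsub>mpol_ring n\<^esub> monomial c \<in> ?P"
      using bc B C by (intro ideal_prod.prod monomial_in_monomial_ideal)
    then show "monomial x \<in> ?P"
      by (simp add: mpol_ring_eq monomial_def mult_single bc)
  qed
  finally show "?M \<subseteq> ?P" .
qed

fun exponent_multiple :: "(nat \<Rightarrow>\<^sub>0 nat) set \<Rightarrow> nat \<Rightarrow> (nat \<Rightarrow>\<^sub>0 nat) set" where
  "exponent_multiple B 0 = {0}"
| "exponent_multiple B (Suc j) = exponent_sums (exponent_multiple B j) B"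

lemma keys_exponent_multiple:
  assumes "\<And>b. b \<in> B \<Longrightarrow> Poly_Mapping.keys b \<subseteq> {..<n}" "b \<in> exponent_multiple B j"
  shows "Poly_Mapping.keys b \<subseteq> {..<n}"
  using assms(2)
proof (induction j arbitrary: b)
  case (Suc j)
  then obtain u v where uv: "u \<in> exponent_multiple B j" "v \<in> B" "b = u + v" by (auto simp: exponent_sums_def)
  then show ?case using Suc.IH[OF uv(1)] assms(1)[OF uv(2)] by (simp add: keys_add_nat)
qed simp

lemma ideal_power_monomial_ideal:
  assumes B: "\<And>b. b \<in> B \<Longrightarrow> Poly_Mapping.keys b \<subseteq> {..<n}"
  shows "ideal_power (mpol_ring n) (monomial_ideal n B) j =
           (monomial_ideal n (exponent_multiple B j) :: 'a::field mpol set)"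
proof (induction j)
  case 0
  then show ?case
    by (auto simp: ideal_power_def nat_pow_def ideals_set_def mpol_ring_eq monomial_ideal_def)
next
  case (Suc j)
  have "ideal_power (mpol_ring n) (monomial_ideal n B) (Suc j) =
      ideal_prod (mpol_ring n) (ideal_power (mpol_ring n) (monomial_ideal n B) j)
        (monomial_ideal n B :: 'a mpol set)"
    by (simp add: ideal_power_def nat_pow_def ideals_set_def)
  then show ?case
    using ideal_prod_monomial_ideal[of "exponent_multiple B j" n B] B keys_exponent_multiple[OF B]
    by (simp add: Suc.IH)
qed

section \<open>Minimal numbers of generators\<close>

definition mpol_scale :: "'a::field \<Rightarrow> 'a mpol \<Rightarrow> 'a mpol" where
  "mpol_scale c p = Poly_Mapping.single 0 c * p"

lemma lookup_mpol_scale [simp]: "Poly_Mapping.lookup (mpol_scale c p) b = c * Poly_Mapping.lookup p b"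
  by (simp add: mpol_scale_def lookup_const_mult)

interpretation mpol: vector_space mpol_scale
  by unfold_locales (auto intro!: poly_mapping_eqI simp: lookup_add algebra_simps)

lemma inj_monomial: "inj (monomial :: _ \<Rightarrow> 'a::field mpol)"
  proof (rule injI)
  fix b c assume "monomial b = (monomial c :: 'a mpol)"
  then have "Poly_Mapping.keys (monomial b :: 'a mpol) = Poly_Mapping.keys (monomial c :: 'a mpol)" by simp
  then show "b = c" by (simp add: monomial_def)
qed

lemma independent_monomials: "mpol.independent (monomial ` B)"
  unfolding mpol.independent_explicit_finite_subsets
proof (intro allI impI ballI)
  fix S and u :: "'a mpol \<Rightarrow> 'a" and v
  assume S: "S \<subseteq> monomial ` B" "finite S" "(\<Sum>v\<in>S. mpol_scale (u v) v) = 0" "v \<in> S"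
  obtain b where b: "v = monomial b" using S by blast
  have "0 = (\<Sum>w\<in>S. u w * Poly_Mapping.lookup w b)"
    using arg_cong[OF S(3), of "\<lambda>p. Poly_Mapping.lookup p b"] by (simp add: lookup_sum)
  also have "\<dots> = (\<Sum>w\<in>S. if w = v then u v else 0)"
  proof (intro sum.cong refl)
    fix w assume "w \<in> S"
    then obtain b' where "w = monomial b'" using S(1) by blast
    then show "u w * Poly_Mapping.lookup w b = (if w = v then u v else 0)"
      by (simp add: b inj_eq[OF inj_monomial]) (auto simp: monomial_def lookup_single)
  qed
  also have "\<dots> = u v" using S by simp
  finally show "u v = 0" by simp
qed

definition exponent_degree :: "nat \<Rightarrow> (nat \<Rightarrow>\<^sub>0 nat) \<Rightarrow> nat" where
  "exponent_degree n b = (\<Sum>i<n. Poly_Mapping.lookup b i)"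

lemma exponent_degree_add: "exponent_degree n (b + c) = exponent_degree n b + exponent_degree n c"
  by (simp add: exponent_degree_def lookup_add sum.distrib)

lemma exponent_degree_eq_0:
  assumes "Poly_Mapping.keys b \<subseteq> {..<n}" "exponent_degree n b = 0"
  shows "b = 0"
proof (rule poly_mapping_eqI)
  fix i
  show "Poly_Mapping.lookup b i = Poly_Mapping.lookup 0 i"
    using assms by (cases "i < n") (auto simp: exponent_degree_def in_keys_iff)
qed

text \<open>
  Let \<open>top p\<close> be the part of \<open>p\<close> supported on \<open>B\<close>. Since the exponents in \<open>B\<close> have the smallest degree
  that occurs in the ideal, multiplying an element of the ideal by \<open>x\<close> multiplies its \<open>top\<close> by the
  constant coefficient of \<open>x\<close>. So the elements of the ideal whose \<open>top\<close> lies in the span of the tops of a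
  generating set form an ideal, which must be everything; and the monomials with exponents in \<open>B\<close> are
  linearly independent.
\<close>

lemma min_num_gens_monomial_ideal:
  assumes fin: "finite B" and B: "\<And>b. b \<in> B \<Longrightarrow> Poly_Mapping.keys b \<subseteq> {..<n}"
    and deg: "\<And>b. b \<in> B \<Longrightarrow> exponent_degree n b = d"
  shows "min_num_gens (mpol_ring n) (monomial_ideal n B :: 'a::field mpol set) = card B"
  unfolding min_num_gens_def
proof (rule Least_equality)
  let ?I = "monomial_ideal n B :: 'a mpol set" and ?S = "mpol_carrier n :: 'a mpol set"
  interpret ring "mpol_ring n :: 'a mpol ring"
    unfolding mpol_ring_eq by (rule ring_ring_on) simp
  have idI: "ideal ?I (ring_on ?S)" using ideal_monomial_ideal by (simp add: mpol_ring_eq)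
  have card: "card (monomial ` B :: 'a mpol set) = card B"
    by (rule card_image) (rule inj_on_subset[OF inj_monomial], simp)
  have "monomial ` B \<subseteq> ?I" using B monomial_in_monomial_ideal by blast
  then have "monomial ` B \<subseteq> carrier (mpol_ring n :: 'a mpol ring)"
    using ideal_ring_onD(1)[OF idI] by (auto simp: mpol_ring_eq)
  then show "\<exists>A. A \<subseteq> carrier (mpol_ring n) \<and> finite A \<and> card A = card B \<and> Idl\<^bsub>mpol_ring n\<^esub> A = ?I"
    using fin card genideal_monomials[OF B] by (intro exI[of _ "monomial ` B"]) simp
  fix m assume "\<exists>A. A \<subseteq> carrier (mpol_ring n) \<and> finite A \<and> card A = m \<and> Idl\<^bsub>mpol_ring n\<^esub> A = ?I"
  then obtain A where A: "A \<subseteq> ?S" "finite A" "card A = m" "Idl\<^bsub>mpol_ring n\<^esub> A = ?I"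
    by (auto simp: mpol_ring_eq)
  define top where "top = (\<lambda>p :: 'a mpol. \<Sum>b\<in>B. Poly_Mapping.single b (Poly_Mapping.lookup p b))"
  have lookup_top: "Poly_Mapping.lookup (top p) b = (if b \<in> B then Poly_Mapping.lookup p b else 0)" for p b
    using fin by (simp add: top_def lookup_sum lookup_single when_def)
  have top_add: "top (p + q) = top p + top q" for p q
    by (rule poly_mapping_eqI) (simp add: lookup_top lookup_add)
  have top_mult: "top (x * p) = mpol_scale (Poly_Mapping.lookup x 0) (top p)"
    if x: "x \<in> ?S" and p: "p \<in> ?I" for x p
  proof (rule poly_mapping_eqI)
    fix b
    show "Poly_Mapping.lookup (top (x * p)) b =
            Poly_Mapping.lookup (mpol_scale (Poly_Mapping.lookup x 0) (top p)) b"
    proof (cases "b \<in> B")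
      case True
      have zero: "u = 0" if uv: "u \<in> Poly_Mapping.keys x" "v \<in> Poly_Mapping.keys p" "u + v = b" for u v
      proof -
        obtain c w where "c \<in> B" "v = c + w" using p uv(2) by (auto simp: monomial_ideal_def)
        then have "exponent_degree n u = 0"
          using deg[OF True] deg[of c] by (auto simp: exponent_degree_add simp flip: uv(3))
        moreover have "Poly_Mapping.keys u \<subseteq> {..<n}" using x uv(1) by (auto simp: mpol_carrier_def)
        ultimately show ?thesis by (intro exponent_degree_eq_0)
      qed
      have "Poly_Mapping.lookup (x * p) b =
        (\<Sum>u\<in>Poly_Mapping.keys x. \<Sum>v\<in>Poly_Mapping.keys p.
            if u = 0 \<and> v = b then Poly_Mapping.lookup x 0 * Poly_Mapping.lookup p b else 0)"
        unfolding lookup_mult_sum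
      proof (intro sum.cong refl)
        fix u v assume uv: "u \<in> Poly_Mapping.keys x" "v \<in> Poly_Mapping.keys p"
        show "(if u + v = b then Poly_Mapping.lookup x u * Poly_Mapping.lookup p v else 0) =
              (if u = 0 \<and> v = b then Poly_Mapping.lookup x 0 * Poly_Mapping.lookup p b else 0)"
        proof (cases "u + v = b")
          case True
          then show ?thesis using zero[OF uv True] by simp
        qed auto
      qed
      also have "\<dots> = (\<Sum>u\<in>Poly_Mapping.keys x. if u = 0 then
            (\<Sum>v\<in>Poly_Mapping.keys p. if v = b then Poly_Mapping.lookup x 0 * Poly_Mapping.lookup p b else 0) else 0)"
        by (intro sum.cong refl) simp
      also have "\<dots> = Poly_Mapping.lookup x 0 * Poly_Mapping.lookup p b"
        by (simp add: in_keys_iff)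
      finally show ?thesis using True by (simp add: lookup_top)
    qed (simp add: lookup_top)
  qed
  let ?J = "{p \<in> ?I. top p \<in> mpol.span (top ` A)}"
  have idJ: "ideal ?J (mpol_ring n)"
    unfolding mpol_ring_eq
  proof (rule ideal_ring_onI)
    show "?J \<subseteq> ?S" using ideal_ring_onD(1)[OF idI] by auto
    have "top 0 = 0" by (simp add: top_def)
    then show "0 \<in> ?J" using ideal_ring_onD(2)[OF idI] by (simp add: mpol.span_zero)
    show "x + y \<in> ?J" if "x \<in> ?J" "y \<in> ?J" for x y
      using that ideal_ring_onD(3)[OF idI, of x y] by (simp add: top_add mpol.span_add)
    show "x * y \<in> ?J" if "x \<in> ?S" "y \<in> ?J" for x y
      using that ideal_ring_onD(4)[OF idI, of x y] by (simp add: top_mult mpol.span_scale)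
  qed simp
  have "A \<subseteq> carrier (mpol_ring n :: 'a mpol ring)" using A by (simp add: mpol_ring_eq)
  then have "A \<subseteq> ?I" using genideal_self[of A] A(4) by simp
  then have "A \<subseteq> ?J" by (auto intro: mpol.span_base)
  then have "?I \<subseteq> ?J" using genideal_minimal[OF idJ, of A] A(4) by simp
  have "monomial ` B \<subseteq> mpol.span (top ` A)"
  proof
    fix p :: "'a mpol" assume "p \<in> monomial ` B"
    then obtain b where b: "b \<in> B" "p = monomial b" by blast
    then have "p \<in> ?J" using \<open>?I \<subseteq> ?J\<close> \<open>monomial ` B \<subseteq> ?I\<close> by blast
    moreover have "top p = p"
      by (rule poly_mapping_eqI) (use b in \<open>auto simp: lookup_top monomial_def lookup_single when_def\<close>)
    ultimately show "p \<in> mpol.span (top ` A)" by simp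
  qed
  then have "card (monomial ` B :: 'a mpol set) \<le> card (top ` A)"
    using mpol.independent_span_bound[of "top ` A" "monomial ` B"] independent_monomials A(2) by blast
  also have "\<dots> \<le> card A" by (rule card_image_le[OF A(2)])
  finally show "card B \<le> m" using card A(3) by simp
qed

section \<open>Krull dimension of subalgebras of a polynomial ring\<close>

text \<open>
  Preimages of primes are prime, and surjectivity keeps the inclusions strict.
\<close>

lemma krull_dim_le_surjective_hom:
  assumes A: "cring A" and B: "cring B" and h: "h \<in> ring_hom A B" and surj: "h ` carrier A = carrier B"
  shows "krull_dim B \<le> krull_dim A"
  unfolding krull_dim_def
proof (rule Sup_subset_mono, rule subsetI)
  interpret ring_hom_ring A B h
    by (rule ring_hom_ringI2) (use A B h in \<open>auto intro: cring.axioms\<close>)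
  fix x assume "x \<in> {enat l |l. \<exists>P. (\<forall>i\<le>l. primeideal (P i) B) \<and> (\<forall>i<l. P i \<subset> P (Suc i))}"
  then obtain l P where x: "x = enat l" and P: "\<And>i. i \<le> l \<Longrightarrow> primeideal (P i) B"
    and chain: "\<And>i. i < l \<Longrightarrow> P i \<subset> P (Suc i)" by blast
  let ?Q = "\<lambda>i. {r \<in> carrier A. h r \<in> P i}"
  have "?Q i \<subset> ?Q (Suc i)" if i: "i < l" for i
  proof -
    obtain z where z: "z \<in> P (Suc i)" "z \<notin> P i" using chain[OF i] by blast
    have "ideal (P (Suc i)) B" using P[of "Suc i"] i by (simp add: primeideal.axioms(1))
    then have "z \<in> carrier B" using z(1) ideal.Icarr by metis
    then obtain r where "r \<in> carrier A" "z = h r" using surj by blast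
    then show ?thesis using z chain[OF i] by blast
  qed
  moreover have "primeideal (?Q i) A" if "i \<le> l" for i
    using P[OF that] by (rule primeideal_vimage[OF A])
  ultimately have "(\<forall>i\<le>l. primeideal (?Q i) A) \<and> (\<forall>i<l. ?Q i \<subset> ?Q (Suc i))"
    by blast
  then show "x \<in> {enat l |l. \<exists>P. (\<forall>i\<le>l. primeideal (P i) A) \<and> (\<forall>i<l. P i \<subset> P (Suc i))}"
    unfolding x by (intro CollectI exI[of _ l] conjI refl exI[of _ ?Q]) auto
qed

lemma krull_dim_ring_iso:
  assumes "cring A" "cring B" "h \<in> ring_iso A B"
  shows "krull_dim A = krull_dim B"
proof (rule antisym)
  interpret A: cring A by fact
  have inv: "inv_into (carrier A) h \<in> ring_iso B A"
    by (rule ring_iso_set_sym) (use assms A.ring_axioms in auto)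
  have "inv_into (carrier A) h ` carrier B = carrier A" "h ` carrier A = carrier B"
    using inv assms(3) by (auto simp: ring_iso_def bij_betw_def)
  then show "krull_dim A \<le> krull_dim B" "krull_dim B \<le> krull_dim A"
    using assms inv by (auto intro!: krull_dim_le_surjective_hom simp: ring_iso_def)
qed

fun power_product :: "(nat \<Rightarrow> 'b::comm_ring_1) \<Rightarrow> nat list \<Rightarrow> 'b" where
  "power_product y [] = 1"
| "power_product y (m # e) = y 0 ^ m * power_product (\<lambda>i. y (Suc i)) e"

lemma is_subring_power:
  assumes "is_subring R" "x \<in> R"
  shows "x ^ m \<in> R"
  by (induction m) (use assms is_subringD[OF assms(1)] in auto)

lemma power_product_in_subring:
  assumes "is_subring R" "\<And>i. i < length e \<Longrightarrow> y i \<in> R"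
  shows "power_product y e \<in> R"
  using assms(2)
proof (induction e arbitrary: y)
  case (Cons m e)
  have "power_product (\<lambda>i. y (Suc i)) e \<in> R" by (rule Cons.IH) (use Cons.prems in auto)
  moreover have "y 0 ^ m \<in> R" using Cons.prems[of 0] is_subring_power[OF assms(1)] by simp
  ultimately show ?case using is_subringD(5)[OF assms(1)] by simp
qed (use is_subringD(2)[OF assms(1)] in simp)

text \<open>
  Induction along the chain. Let \<open>m\<close> be the least exponent of \<open>y 0\<close> in a supposed relation. As \<open>y 0\<close> is
  not in the prime \<open>P 0\<close>, the factor \<open>y 0 ^ m\<close> can be cancelled, and what is left has the form
  \<open>SF + y 0 * SG\<close>, where \<open>SF\<close> does not involve \<open>y 0\<close>. Because \<open>y 0 \<in> P 1\<close>, the element \<open>SF\<close> lies in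
  \<open>P 1\<close>, so \<open>SF\<close> is a shorter relation for the rest of the chain.
\<close>

lemma prime_chain_no_relation:
  fixes T :: "'a::field mpol set" and P :: "nat \<Rightarrow> 'a mpol set"
  assumes T: "is_subring T" and const: "\<And>c. Poly_Mapping.single 0 c \<in> T"
    and P: "\<And>i. i \<le> l \<Longrightarrow> primeideal (P i) (ring_on T)"
    and sub: "\<And>i. i < l \<Longrightarrow> P i \<subseteq> P (Suc i)"
    and y: "\<And>i. i < l \<Longrightarrow> y i \<in> P (Suc i) \<and> y i \<notin> P i"
    and E: "finite E" "\<And>e. e \<in> E \<Longrightarrow> length e = l"
    and rel: "(\<Sum>e\<in>E. mpol_scale (c e) (power_product y e)) \<in> P 0"
    and e: "e \<in> E"
  shows "c e = 0"
  using P sub y E rel e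
proof (induction l arbitrary: P y E c e)
  case 0
  show ?case
  proof (rule ccontr)
    assume "c e \<noteq> 0"
    have "E \<subseteq> {[]}" using 0(5) by auto
    then have "E = {[]}" "e = []" using 0(7) by auto
    then have *: "Poly_Mapping.single 0 (c []) \<in> P 0" using 0(6) by (simp add: mpol_scale_def)
    have pr: "ideal (P 0) (ring_on T)" "1 \<notin> P 0"
      using 0(1)[of 0] by (auto simp: primeideal_ring_on_iff[OF T])
    have "Poly_Mapping.single 0 (1 / c []) * Poly_Mapping.single 0 (c []) \<in> P 0"
      by (rule ideal_ring_onD(4)[OF pr(1) const *])
    also have "Poly_Mapping.single 0 (1 / c []) * Poly_Mapping.single 0 (c []) = (1 :: 'a mpol)"
      using \<open>c e \<noteq> 0\<close> \<open>e = []\<close> by (simp add: mult_single)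
    finally show False using pr(2) by simp
  qed
next
  case (Suc l)
  define y' where "y' = (\<lambda>i. y (Suc i))"
  define E' where "E' = {e \<in> E. c e \<noteq> 0}"
  have finE': "finite E'" using Suc.prems(4) by (simp add: E'_def)
  show ?case
  proof (rule ccontr)
    assume "c e \<noteq> 0"
    then have "e \<in> E'" using Suc.prems(7) by (simp add: E'_def)
    define m where "m = Min (hd ` E')"
    define F where "F = {e \<in> E'. hd e = m}"
    define G where "G = {e \<in> E'. hd e \<noteq> m}"
    have "m \<in> hd ` E'" unfolding m_def using finE' \<open>e \<in> E'\<close> by (intro Min_in) auto
    then obtain e0 where e0: "e0 \<in> F" by (auto simp: F_def)
    have m_le: "m \<le> hd e" if "e \<in> E'" for e unfolding m_def using that finE' by simp
    have Cons: "e = hd e # tl e" "length (tl e) = l" if "e \<in> E'" for e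
      using that Suc.prems(5)[of e] by (cases e; simp add: E'_def)+
    have pr0: "ideal (P 0) (ring_on T)" "1 \<notin> P 0"
      "\<And>x z. x \<in> T \<Longrightarrow> z \<in> T \<Longrightarrow> x * z \<in> P 0 \<Longrightarrow> x \<in> P 0 \<or> z \<in> P 0"
      using Suc.prems(1)[of 0] by (auto simp: primeideal_ring_on_iff[OF T])
    have id: "ideal (P i) (ring_on T)" if "i \<le> Suc l" for i
      using Suc.prems(1)[OF that] by (simp add: primeideal_ring_on_iff[OF T])
    have yT: "y i \<in> T" if "i < Suc l" for i
      using ideal_ring_onD(1)[OF id[of "Suc i"]] Suc.prems(3)[OF that] that by auto
    have ppT: "power_product y' (tl e) \<in> T" if "e \<in> E'" for e
      unfolding y'_def using yT Cons(2)[OF that] by (intro power_product_in_subring[OF T]) auto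
    have scaleT: "mpol_scale a z \<in> T" if "z \<in> T" for a z
      unfolding mpol_scale_def by (rule is_subringD(5)[OF T const that])
    have sumT: "(\<Sum>e\<in>D. f e) \<in> T" if "finite D" "\<And>e. e \<in> D \<Longrightarrow> f e \<in> T" for D and f :: "nat list \<Rightarrow> 'a mpol"
      using that by (induction D rule: finite_induct) (auto intro: is_subringD[OF T])
    define SF where "SF = (\<Sum>e\<in>F. mpol_scale (c e) (power_product y' (tl e)))"
    define SG where "SG = (\<Sum>e\<in>G. mpol_scale (c e) (y 0 ^ (hd e - Suc m) * power_product y' (tl e)))"
    have y0T: "y 0 \<in> T" using yT by simp
    have SFT: "SF \<in> T" unfolding SF_def
      using ppT finE' by (intro sumT scaleT) (auto simp: F_def)
    have SGT: "SG \<in> T" unfolding SG_def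
      using ppT finE' is_subring_power[OF T y0T] is_subringD(5)[OF T]
      by (intro sumT scaleT) (auto simp: G_def)
    have pp: "power_product y e = y 0 ^ hd e * power_product y' (tl e)" if "e \<in> E'" for e
      using power_product.simps(2)[of y "hd e" "tl e"] Cons(1)[OF that] by (simp add: y'_def)
    have "(\<Sum>e\<in>E. mpol_scale (c e) (power_product y e)) =
          (\<Sum>e\<in>E'. mpol_scale (c e) (power_product y e))"
      using Suc.prems(4) by (intro sum.mono_neutral_right) (auto simp: E'_def)
    also have "\<dots> = (\<Sum>e\<in>F. mpol_scale (c e) (power_product y e)) + (\<Sum>e\<in>G. mpol_scale (c e) (power_product y e))"
      using finE' by (subst sum.union_disjoint[symmetric]) (auto simp: F_def G_def intro!: sum.cong)
    also have "(\<Sum>e\<in>F. mpol_scale (c e) (power_product y e)) = y 0 ^ m * SF"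
      unfolding SF_def sum_distrib_left
      by (intro sum.cong) (auto simp: F_def pp mpol_scale_def ac_simps)
    also have "(\<Sum>e\<in>G. mpol_scale (c e) (power_product y e)) = y 0 ^ m * (y 0 * SG)"
      unfolding SG_def sum_distrib_left
    proof (intro sum.cong refl)
      fix e assume "e \<in> G"
      then have e: "e \<in> E'" "hd e \<noteq> m" by (auto simp: G_def)
      then have "hd e = m + Suc (hd e - Suc m)" using m_le[OF e(1)] by simp
      then have "y 0 ^ hd e = y 0 ^ m * (y 0 * y 0 ^ (hd e - Suc m))"
        by (metis power_add power_Suc)
      then show "mpol_scale (c e) (power_product y e) =
          y 0 ^ m * (y 0 * mpol_scale (c e) (y 0 ^ (hd e - Suc m) * power_product y' (tl e)))"
        by (simp add: pp[OF e(1)] mpol_scale_def ac_simps)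
    qed
    finally have "y 0 ^ m * (SF + y 0 * SG) \<in> P 0"
      using Suc.prems(6) by (simp add: algebra_simps)
    moreover have "y 0 ^ m \<notin> P 0"
    proof (induction m)
      case (Suc m)
      have "y 0 \<notin> P 0" using Suc.prems by (use \<open>\<And>i. i < Suc l \<Longrightarrow> y i \<in> P (Suc i) \<and> y i \<notin> P i\<close> in blast)
      then show ?case using pr0(3)[of "y 0" "y 0 ^ m"] Suc y0T is_subring_power[OF T y0T] by auto
    qed (use pr0(2) in simp)
    moreover have "SF + y 0 * SG \<in> T" using SFT SGT y0T is_subringD[OF T] by auto
    ultimately have "SF + y 0 * SG \<in> P 0"
      using pr0(3) is_subring_power[OF T y0T] by blast
    then have 1: "SF + y 0 * SG \<in> P 1" using Suc.prems(2)[of 0] by auto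
    have id1: "ideal (P 1) (ring_on T)" using id[of 1] by simp
    have "y 0 \<in> P 1" using Suc.prems(3)[of 0] by simp
    then have "- 1 * (y 0 * SG) \<in> P 1"
      using ideal_ring_onD(5)[OF id1 _ SGT] ideal_ring_onD(4)[OF id1] is_subringD[OF T] by blast
    from ideal_ring_onD(3)[OF id1 1 this] have "SF \<in> P 1" by simp
    moreover have "SF = (\<Sum>e\<in>tl ` F. mpol_scale (c (m # e)) (power_product y' e))"
    proof -
      have "inj_on tl F"
        by (rule inj_onI) (metis (mono_tags, lifting) Cons(1) F_def mem_Collect_eq)
      then have "(\<Sum>e\<in>tl ` F. mpol_scale (c (m # e)) (power_product y' e)) =
                 (\<Sum>e\<in>F. mpol_scale (c (m # tl e)) (power_product y' (tl e)))"
        by (simp add: sum.reindex)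
      also have "\<dots> = SF"
        unfolding SF_def
      proof (intro sum.cong refl)
        fix e assume "e \<in> F"
        then have "m # tl e = e" using Cons(1)[of e] by (simp add: F_def)
        then show "mpol_scale (c (m # tl e)) (power_product y' (tl e)) =
                   mpol_scale (c e) (power_product y' (tl e))" by simp
      qed
      finally show ?thesis by simp
    qed
    ultimately have rel': "(\<Sum>e\<in>tl ` F. mpol_scale (c (m # e)) (power_product y' e)) \<in> P (Suc 0)"
      by simp
    have "c (m # tl e0) = 0"
    proof (rule Suc.IH[where P = "\<lambda>i. P (Suc i)" and y = y' and E = "tl ` F" and c = "\<lambda>e. c (m # e)"])
      show "primeideal (P (Suc i)) (ring_on T)" if "i \<le> l" for i using Suc.prems(1) that by simp
      show "P (Suc i) \<subseteq> P (Suc (Suc i))" if "i < l" for i using Suc.prems(2) that by simp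
      show "y' i \<in> P (Suc (Suc i)) \<and> y' i \<notin> P (Suc i)" if "i < l" for i
        using Suc.prems(3) that by (simp add: y'_def)
      show "finite (tl ` F)" using finE' by (simp add: F_def)
      show "length e = l" if "e \<in> tl ` F" for e using that Cons(2) by (auto simp: F_def)
      show "(\<Sum>e\<in>tl ` F. mpol_scale (c (m # e)) (power_product y' e)) \<in> P (Suc 0)" by (rule rel')
      show "tl e0 \<in> tl ` F" using e0 by blast
    qed
    moreover have "m # tl e0 = e0" using e0 Cons(1)[of e0] by (simp add: F_def)
    ultimately show False using e0 by (simp add: F_def E'_def)
  qed
qed

definition exponent_bounded :: "nat \<Rightarrow> nat \<Rightarrow> 'a::field mpol \<Rightarrow> bool" where
  "exponent_bounded n D p \<longleftrightarrow> (\<forall>b\<in>Poly_Mapping.keys p. Poly_Mapping.keys b \<subseteq> {..<n} \<and> (\<forall>j. Poly_Mapping.lookup b j \<le> D))"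

lemma exponent_bounded_1: "exponent_bounded n 0 1"
  by (simp add: exponent_bounded_def)

lemma exponent_bounded_mult:
  assumes "exponent_bounded n D p" "exponent_bounded n D' q"
  shows "exponent_bounded n (D + D') (p * q)"
  unfolding exponent_bounded_def
proof
  fix b assume "b \<in> Poly_Mapping.keys (p * q)"
  then obtain u v where "u \<in> Poly_Mapping.keys p" "v \<in> Poly_Mapping.keys q" "b = u + v" by (rule keys_multE)
  then show "Poly_Mapping.keys b \<subseteq> {..<n} \<and> (\<forall>j. Poly_Mapping.lookup b j \<le> D + D')"
    using assms by (simp add: exponent_bounded_def keys_add_nat lookup_add add_mono)
qed

lemma exponent_bounded_power:
  assumes "exponent_bounded n D p"
  shows "exponent_bounded n (D * m) (p ^ m)"
proof (induction m)
  case 0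
  then show ?case by (simp add: exponent_bounded_1)
next
  case (Suc m)
  then show ?case using exponent_bounded_mult[OF assms Suc] by simp
qed

lemma exponent_bounded_power_product:
  assumes "\<And>i. i < length e \<Longrightarrow> exponent_bounded n D (y i)"
  shows "exponent_bounded n (D * sum_list e) (power_product y e)"
  using assms
proof (induction e arbitrary: y)
  case Nil
  then show ?case by (simp add: exponent_bounded_1)
next
  case (Cons m e)
  have "exponent_bounded n (D * sum_list e) (power_product (\<lambda>i. y (Suc i)) e)"
    by (rule Cons.IH) (use Cons.prems in auto)
  moreover have "exponent_bounded n (D * m) (y 0 ^ m)"
    using Cons.prems[of 0] by (intro exponent_bounded_power) simp
  ultimately show ?case using exponent_bounded_mult by (simp add: distrib_left)
qed

lemma exponent_bounded_mono: "exponent_bounded n D p \<Longrightarrow> D \<le> D' \<Longrightarrow> exponent_bounded n D' p"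
  by (auto simp: exponent_bounded_def intro: order_trans)

lemma exponent_bounded_ex:
  assumes "p \<in> mpol_carrier n"
  shows "\<exists>D. exponent_bounded n D p"
proof -
  let ?V = "\<Union>b\<in>Poly_Mapping.keys p. Poly_Mapping.lookup b ` Poly_Mapping.keys b"
  have "Poly_Mapping.lookup b j \<le> Max (insert 0 ?V)" if "b \<in> Poly_Mapping.keys p" for b j
  proof (cases "j \<in> Poly_Mapping.keys b")
    case True
    then show ?thesis using that by (intro Max_ge) auto
  qed (simp add: in_keys_iff)
  then show ?thesis
    using assms unfolding exponent_bounded_def mpol_carrier_def by blast
qed

lemma card_bounded_exponents:
  fixes n L :: nat
  defines "W \<equiv> {b. Poly_Mapping.keys b \<subseteq> {..<n} \<and> (\<forall>j. Poly_Mapping.lookup b j \<le> (L::nat))}"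
  shows "finite W" "card W \<le> (L + 1) ^ n"
proof -
  let ?f = "\<lambda>b. map (Poly_Mapping.lookup b) [0..<n]"
  let ?L = "{xs. set xs \<subseteq> {..L} \<and> length xs = n}"
  have inj: "inj_on ?f W"
  proof (rule inj_onI, rule poly_mapping_eqI)
    fix b c j assume bc: "b \<in> W" "c \<in> W" "?f b = ?f c"
    show "Poly_Mapping.lookup b j = Poly_Mapping.lookup c j"
    proof (cases "j < n")
      case True
      then show ?thesis using bc(3) by (simp add: map_eq_conv)
    next
      case False
      then have "j \<notin> Poly_Mapping.keys b" "j \<notin> Poly_Mapping.keys c" using bc by (auto simp: W_def)
      then show ?thesis by (simp add: in_keys_iff)
    qed
  qed
  have img: "?f ` W \<subseteq> ?L" by (auto simp: W_def)
  have fin: "finite ?L" by (rule finite_lists_length_eq) simp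
  show "finite W" using inj img fin by (meson finite_imageD finite_subset)
  have "card W \<le> card ?L" using inj img fin by (rule card_inj_on_le)
  also have "\<dots> = (L + 1) ^ n" by (simp add: card_lists_length_eq)
  finally show "card W \<le> (L + 1) ^ n" .
qed

text \<open>
  The \<open>N ^ (n + 1)\<close> power products with exponents below \<open>N\<close> lie in the span of the monomials whose
  exponents are bounded by a constant multiple of \<open>N\<close>. There are only \<open>O(N ^ n)\<close> of these, so for large
  \<open>N\<close> the power products are linearly dependent.
\<close>

lemma algebraic_dependence:
  fixes y :: "nat \<Rightarrow> 'a::field mpol"
  assumes y: "\<And>i. i \<le> n \<Longrightarrow> y i \<in> mpol_carrier n"
  shows "\<exists>E c. finite E \<and> (\<forall>e\<in>E. length e = Suc n) \<and> (\<exists>e\<in>E. c e \<noteq> 0) \<and>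
           (\<Sum>e\<in>E. mpol_scale (c e) (power_product y e)) = 0"
proof -
  obtain D where D: "\<And>i. i \<le> n \<Longrightarrow> exponent_bounded n D (y i)"
  proof -
    have "\<forall>i. \<exists>d. i \<le> n \<longrightarrow> exponent_bounded n d (y i)" using exponent_bounded_ex y by blast
    then obtain f where f: "\<And>i. i \<le> n \<Longrightarrow> exponent_bounded n (f i) (y i)" by metis
    have "f i \<le> Max (f ` {..n})" if "i \<le> n" for i using that by (intro Max_ge) auto
    then show thesis using that[of "Max (f ` {..n})"] f exponent_bounded_mono by blast
  qed
  \<comment> \<open>\<open>L\<close> bounds the exponents in the power products, and \<open>L + 1 \<le> Q * N\<close>; the choice of \<open>N\<close> makes \<open>(Q * N) ^ n < N ^ Suc n\<close>.\<close>
  define Q where "Q = D * Suc n + 1"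
  define N where "N = Q ^ n + 1"
  define L where "L = D * (Suc n * N)"
  define E where "E = {e. set e \<subseteq> {..<N} \<and> length e = Suc n}"
  define W where "W = {b. Poly_Mapping.keys b \<subseteq> {..<n} \<and> (\<forall>j. Poly_Mapping.lookup b j \<le> L)}"
  have finE: "finite E" unfolding E_def by (rule finite_lists_length_eq) simp
  have cardE: "card E = N ^ Suc n" unfolding E_def by (subst card_lists_length_eq) auto
  have finW: "finite W" and "card W \<le> (L + 1) ^ n"
    using card_bounded_exponents[of n L] by (auto simp: W_def)
  have "L + 1 \<le> Q * N" by (simp add: L_def Q_def N_def algebra_simps)
  then have "(L + 1) ^ n \<le> (Q * N) ^ n" by (rule power_mono) simp
  also have "\<dots> = Q ^ n * N ^ n" by (rule power_mult_distrib)
  also have "\<dots> < N * N ^ n" by (rule mult_strict_right_mono) (auto simp: N_def)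
  finally have "card W < card E" using \<open>card W \<le> (L + 1) ^ n\<close> by (simp add: cardE)
  have in_span: "power_product y e \<in> mpol.span (monomial ` W)" if e: "e \<in> E" for e
  proof -
    let ?p = "power_product y e"
    have "sum_list e \<le> length e * N"
    proof -
      have "x \<le> N" if "x \<in> set e" for x
        using e that by (auto simp: E_def intro: less_imp_le)
      then have "sum_list e \<le> (\<Sum>x\<leftarrow>e. N)"
        using sum_list_mono[of e "\<lambda>x. x" "\<lambda>_. N"] by simp
      then show ?thesis by (simp add: sum_list_triv)
    qed
    then have "D * sum_list e \<le> L" using e by (auto simp: E_def L_def intro: mult_le_mono2)
    moreover have "exponent_bounded n (D * sum_list e) ?p"
      using D e by (intro exponent_bounded_power_product) (auto simp: E_def)
    ultimately have "exponent_bounded n L ?p" using exponent_bounded_mono by blast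
    then have "Poly_Mapping.keys ?p \<subseteq> W" by (auto simp: exponent_bounded_def W_def)
    then have "(\<Sum>b\<in>Poly_Mapping.keys ?p. mpol_scale (Poly_Mapping.lookup ?p b) (monomial b)) \<in> mpol.span (monomial ` W)"
      by (intro mpol.span_sum mpol.span_scale mpol.span_base) auto
    also have "(\<Sum>b\<in>Poly_Mapping.keys ?p. mpol_scale (Poly_Mapping.lookup ?p b) (monomial b)) = ?p"
      by (subst (3) mpol_sum_monomials) (simp add: mpol_scale_def monomial_def mult_single)
    finally show ?thesis .
  qed
  show ?thesis
  proof (cases "inj_on (power_product y) E")
    case False
    then obtain e e' where ee: "e \<in> E" "e' \<in> E" "e \<noteq> e'" "power_product y e = power_product y e'"
      by (auto simp: inj_on_def)
    let ?c = "\<lambda>x. if x = e then 1 else - 1 :: 'a"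
    have "(\<Sum>x\<in>{e, e'}. mpol_scale (?c x) (power_product y x)) = 0"
      using ee by (simp add: mpol.scale_minus_left)
    then show ?thesis using ee
      by (intro exI[of _ "{e, e'}"] exI[of _ ?c]) (auto simp: E_def)
  next
    case True
    let ?S = "power_product y ` E"
    have "\<not> mpol.independent ?S"
    proof
      assume "mpol.independent ?S"
      moreover have "?S \<subseteq> mpol.span (monomial ` W)" using in_span by blast
      ultimately have "card ?S \<le> card (monomial ` W :: 'a mpol set)"
        using mpol.independent_span_bound finW by blast
      also have "\<dots> \<le> card W" by (rule card_image_le[OF finW])
      finally show False using \<open>card W < card E\<close> True by (simp add: card_image)
    qed
    then obtain t u v where t: "finite t" "t \<subseteq> ?S" "(\<Sum>w\<in>t. mpol_scale (u w) w) = 0" "v \<in> t" "u v \<noteq> 0"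
      unfolding mpol.dependent_explicit by blast
    define E0 where "E0 = {e \<in> E. power_product y e \<in> t}"
    have img: "power_product y ` E0 = t" using t(2) by (auto simp: E0_def)
    have inj: "inj_on (power_product y) E0" using True by (rule inj_on_subset) (auto simp: E0_def)
    have "(\<Sum>e\<in>E0. mpol_scale (u (power_product y e)) (power_product y e)) = 0"
      using t(3) unfolding img[symmetric] by (simp add: sum.reindex[OF inj])
    moreover have "\<exists>e\<in>E0. u (power_product y e) \<noteq> 0" using t(4,5) img by blast
    moreover have "finite E0" using finE by (simp add: E0_def)
    moreover have "\<forall>e\<in>E0. length e = Suc n" by (simp add: E0_def E_def)
    ultimately show ?thesis by (intro exI[of _ E0] exI[of _ "\<lambda>e. u (power_product y e)"]) auto
  qed
qed

text \<open>
  A chain of length \<open>n + 1\<close> would produce \<open>n + 1\<close> algebraically independent polynomials in \<open>n\<close>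
  variables.
\<close>

theorem krull_dim_subalgebra_le:
  fixes T :: "'a::field mpol set"
  assumes T: "is_subring T" and const: "\<And>c. Poly_Mapping.single 0 c \<in> T" and sub: "T \<subseteq> mpol_carrier n"
  shows "krull_dim (ring_on T) \<le> enat n"
  unfolding krull_dim_def
proof (rule Sup_least)
  fix x assume "x \<in> {enat l |l. \<exists>P. (\<forall>i\<le>l. primeideal (P i) (ring_on T)) \<and> (\<forall>i<l. P i \<subset> P (Suc i))}"
  then obtain l P where x: "x = enat l" and P: "\<And>i. i \<le> l \<Longrightarrow> primeideal (P i) (ring_on T)"
    and chain: "\<And>i. i < l \<Longrightarrow> P i \<subset> P (Suc i)" by blast
  have "l \<le> n"
  proof (rule ccontr)
    assume "\<not> l \<le> n"
    then have nl: "Suc n \<le> l" by simp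
    have "\<forall>i. \<exists>z. i < l \<longrightarrow> z \<in> P (Suc i) \<and> z \<notin> P i" using chain by blast
    then obtain y where y: "\<And>i. i < l \<Longrightarrow> y i \<in> P (Suc i) \<and> y i \<notin> P i" by metis
    have id: "ideal (P i) (ring_on T)" if "i \<le> l" for i
      using P[OF that] by (simp add: primeideal_ring_on_iff[OF T])
    have "y i \<in> mpol_carrier n" if "i \<le> n" for i
      using y[of i] ideal_ring_onD(1)[OF id[of "Suc i"]] that nl sub by auto
    from algebraic_dependence[of n y, OF this] obtain E c e where E: "finite E"
      "\<forall>e\<in>E. length e = Suc n" "e \<in> E" "c e \<noteq> 0"
      "(\<Sum>e\<in>E. mpol_scale (c e) (power_product y e)) = 0" by blast
    have "c e = 0"
    proof (rule prime_chain_no_relation[OF T const, where P = P and l = "Suc n" and y = y and E = E])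
      show "(\<Sum>e\<in>E. mpol_scale (c e) (power_product y e)) \<in> P 0"
        using E(5) ideal_ring_onD(2)[OF id[of 0]] by simp
      show "P i \<subseteq> P (Suc i)" if "i < Suc n" for i using chain[of i] that nl by auto
    qed (use P y E nl in auto)
    then show False using E by simp
  qed
  then show "x \<le> enat n" using x by simp
qed

section \<open>Krull dimension of toric rings\<close>

text \<open>
  For an additive \<open>h\<close> this is the homomorphism of monoid algebras that \<open>h\<close> induces.
\<close>

definition push_exponents :: "((nat \<Rightarrow>\<^sub>0 nat) \<Rightarrow> (nat \<Rightarrow>\<^sub>0 nat)) \<Rightarrow> 'a::field mpol \<Rightarrow> 'a mpol" where
  "push_exponents h p = (\<Sum>b\<in>Poly_Mapping.keys p. Poly_Mapping.single (h b) (Poly_Mapping.lookup p b))"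

lemma push_exponents_add: "push_exponents h (p + q) = push_exponents h p + push_exponents h q"
  unfolding push_exponents_def by (rule setsum_keys_plus_distrib) (simp_all add: single_add)

lemma push_exponents_0 [simp]: "push_exponents h 0 = 0"
  by (simp add: push_exponents_def)

lemma push_exponents_single [simp]:
  "push_exponents h (Poly_Mapping.single b c) = Poly_Mapping.single (h b) c"
  by (simp add: push_exponents_def)

lemma push_exponents_sum: "push_exponents h (\<Sum>x\<in>A. f x) = (\<Sum>x\<in>A. push_exponents h (f x))"
  by (induction A rule: infinite_finite_induct) (simp_all add: push_exponents_add)

lemma push_exponents_uminus: "push_exponents h (- p) = - push_exponents h p"
  using push_exponents_add[of h p "- p"] by (simp add: eq_neg_iff_add_eq_0 add.commute)

lemma push_exponents_mult:
  fixes p q :: "'a::field mpol"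
  assumes "\<And>u v. h (u + v) = h u + h v"
  shows "push_exponents h (p * q) = push_exponents h p * push_exponents h q"
proof -
  have "p * q = (\<Sum>u\<in>Poly_Mapping.keys p. Poly_Mapping.single u (Poly_Mapping.lookup p u)) *
                (\<Sum>v\<in>Poly_Mapping.keys q. Poly_Mapping.single v (Poly_Mapping.lookup q v))"
    using mpol_sum_monomials[of p] mpol_sum_monomials[of q] by simp
  also have "\<dots> = (\<Sum>u\<in>Poly_Mapping.keys p. \<Sum>v\<in>Poly_Mapping.keys q.
       Poly_Mapping.single (u + v) (Poly_Mapping.lookup p u * Poly_Mapping.lookup q v))"
    by (simp add: sum_product mult_single)
  finally have "push_exponents h (p * q) = (\<Sum>u\<in>Poly_Mapping.keys p. \<Sum>v\<in>Poly_Mapping.keys q.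
       Poly_Mapping.single (h u + h v) (Poly_Mapping.lookup p u * Poly_Mapping.lookup q v))"
    by (simp add: push_exponents_sum assms)
  then show ?thesis by (simp add: push_exponents_def sum_product mult_single)
qed

lemma push_exponents_comp: "push_exponents g (push_exponents h p) = push_exponents (\<lambda>b. g (h b)) p"
  unfolding push_exponents_def[of h] push_exponents_def[of "\<lambda>b. g (h b)"]
  by (simp add: push_exponents_sum)

lemma lookup_push_exponents:
  "Poly_Mapping.lookup (push_exponents h p) a =
     (\<Sum>b\<in>Poly_Mapping.keys p. if h b = a then Poly_Mapping.lookup p b else 0)"
  by (simp add: push_exponents_def lookup_sum lookup_single when_def)

definition toric_ring :: "(nat \<Rightarrow>\<^sub>0 nat) set \<Rightarrow> 'a::field mpol set" where
  "toric_ring M = {p. Poly_Mapping.keys p \<subseteq> M}"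

lemma is_subring_toric_ring:
  assumes "0 \<in> M" "\<And>u v. u \<in> M \<Longrightarrow> v \<in> M \<Longrightarrow> u + v \<in> M"
  shows "is_subring (toric_ring M)"
  unfolding is_subring_def toric_ring_def
  using assms by (auto simp: keys_uminus elim!: keys_multE keys_addE)

text \<open>
  The kernel of a homomorphism into a domain.
\<close>

lemma primeideal_push_exponents:
  fixes T :: "'a::field mpol set"
  assumes T: "is_subring T" and h: "\<And>u v. h (u + v) = h u + h v"
  shows "primeideal {p \<in> T. push_exponents h p = 0} (ring_on T)"
  unfolding primeideal_ring_on_iff[OF T]
proof (intro conjI ballI impI)
  note D = is_subringD[OF T]
  show "ideal {p \<in> T. push_exponents h p = 0} (ring_on T)"
    by (rule ideal_ring_onI) (use T D in \<open>auto simp: push_exponents_add push_exponents_mult[OF h]\<close>)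
  have "h 0 = 0" using h[of 0 0] by simp
  then have "push_exponents h (1 :: 'a mpol) = 1"
    using push_exponents_single[of h 0 "1 :: 'a"] by simp
  then show "1 \<notin> {p \<in> T. push_exponents h p = 0}" by auto
  show "x \<in> {p \<in> T. push_exponents h p = 0} \<or> z \<in> {p \<in> T. push_exponents h p = 0}"
    if "x \<in> T" "z \<in> T" "x * z \<in> {p \<in> T. push_exponents h p = 0}" for x z
    using that by (auto simp: push_exponents_mult[OF h])
qed

lemma add_eq_0_exponent: "u + v = 0 \<longleftrightarrow> u = 0 \<and> v = (0 :: nat \<Rightarrow>\<^sub>0 nat)"
  by (auto simp: poly_mapping_eq_iff fun_eq_iff lookup_add)

lemma lookup_mult_0: "Poly_Mapping.lookup (p * q) 0 = Poly_Mapping.lookup p 0 * Poly_Mapping.lookup (q :: 'a::field mpol) 0"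
proof -
  have "Poly_Mapping.lookup (p * q) 0 = (\<Sum>u\<in>Poly_Mapping.keys p. if u = 0 then
          (\<Sum>v\<in>Poly_Mapping.keys q. if v = 0 then Poly_Mapping.lookup p 0 * Poly_Mapping.lookup q 0 else 0) else 0)"
    unfolding lookup_mult_sum by (intro sum.cong refl) (auto simp: add_eq_0_exponent intro!: sum.cong)
  then show ?thesis by (simp add: in_keys_iff)
qed

lemma primeideal_constant_coeff_0:
  fixes T :: "'a::field mpol set"
  assumes T: "is_subring T"
  shows "primeideal {p \<in> T. Poly_Mapping.lookup p 0 = 0} (ring_on T)"
  unfolding primeideal_ring_on_iff[OF T]
proof (intro conjI ballI impI)
  show "ideal {p \<in> T. Poly_Mapping.lookup p 0 = 0} (ring_on T)"
    by (rule ideal_ring_onI) (use T is_subringD[OF T] in \<open>auto simp: lookup_add lookup_mult_0\<close>)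
qed (auto simp: lookup_mult_0)

text \<open>
  The coordinates \<open>1, \<dots>, i - 1\<close> are dropped, and coordinate \<open>0\<close> is replaced by the total degree. For
  \<open>i = 1\<close> nothing is lost, and for \<open>i = n\<close> only the degree is left.
\<close>

definition forget_below :: "nat \<Rightarrow> nat \<Rightarrow> (nat \<Rightarrow>\<^sub>0 nat) \<Rightarrow> (nat \<Rightarrow>\<^sub>0 nat)" where
  "forget_below n i b = Poly_Mapping.single 0 (exponent_degree n b) +
     (\<Sum>l\<in>{i..<n}. Poly_Mapping.single l (Poly_Mapping.lookup b l))"

lemma forget_below_add: "forget_below n i (u + v) = forget_below n i u + forget_below n i v"
  by (simp add: forget_below_def exponent_degree_add lookup_add single_add sum.distrib ac_simps)

lemma lookup_forget_below:
  assumes "i > 0"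
  shows "Poly_Mapping.lookup (forget_below n i b) l =
           (if l = 0 then exponent_degree n b else if i \<le> l \<and> l < n then Poly_Mapping.lookup b l else 0)"
proof -
  have "Poly_Mapping.lookup (\<Sum>l\<in>{i..<n}. Poly_Mapping.single l (Poly_Mapping.lookup b l)) l =
          (\<Sum>m\<in>{i..<n}. if m = l then Poly_Mapping.lookup b l else 0)"
    unfolding lookup_sum by (intro sum.cong) (auto simp: lookup_single)
  then show ?thesis using assms by (auto simp: forget_below_def lookup_add lookup_single)
qed

text \<open>
  The chain consists of the kernels of the maps induced by \<open>forget_below n i\<close> for \<open>i = 1, \<dots>, n\<close>, followed by
  the ideal of all elements without constant term. Dropping one more coordinate factors through the
  previous map, so the kernels increase; the difference of two monomials whose exponents differ by
  moving one unit from coordinate \<open>i\<close> to coordinate \<open>0\<close> shows that they increase strictly. In the last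
  step a monomial with nonzero exponent separates the two ideals.
\<close>

theorem krull_dim_toric_ring_ge:
  assumes n: "n > 0" and M0: "0 \<in> M" and Madd: "\<And>u v. u \<in> M \<Longrightarrow> v \<in> M \<Longrightarrow> u + v \<in> M"
    and Mn: "\<And>b. b \<in> M \<Longrightarrow> Poly_Mapping.keys b \<subseteq> {..<n}"
    and nz: "b \<in> M" "b \<noteq> 0"
    and shift: "\<And>i. 0 < i \<Longrightarrow> i < n \<Longrightarrow>
        \<exists>c. c + Poly_Mapping.single i 1 \<in> M \<and> c + Poly_Mapping.single 0 1 \<in> M"
  shows "enat n \<le> krull_dim (ring_on (toric_ring M :: 'a::field mpol set))"
proof -
  let ?T = "toric_ring M :: 'a mpol set"
  have T: "is_subring ?T" by (rule is_subring_toric_ring[OF M0 Madd])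
  define K where "K = (\<lambda>i. {p \<in> ?T. push_exponents (forget_below n i) p = 0})"
  define P where "P = (\<lambda>i. if i < n then K (Suc i) else {p \<in> ?T. Poly_Mapping.lookup p 0 = 0})"
  have prime: "primeideal (P i) (ring_on ?T)" for i
    using primeideal_push_exponents[OF T, of "forget_below n (Suc i)"] primeideal_constant_coeff_0[OF T]
    by (simp add: P_def K_def forget_below_add)
  have monoT: "monomial b \<in> ?T" if "b \<in> M" for b
    using that by (simp add: toric_ring_def monomial_def)
  have step: "P i \<subset> P (Suc i)" if i: "i < n" for i
  proof (cases "Suc i < n")
    case True
    \<comment> \<open>Erasing coordinate \<open>Suc i\<close> leads from one map of the chain to the next.\<close>
    let ?g = "\<lambda>c. Poly_Mapping.update (Suc i) 0 c"
    have comp: "?g (forget_below n (Suc i) b) = forget_below n (Suc (Suc i)) b" for b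
      by (rule poly_mapping_eqI) (auto simp: lookup_update lookup_forget_below)
    have sub: "K (Suc i) \<subseteq> K (Suc (Suc i))"
    proof
      fix p assume p: "p \<in> K (Suc i)"
      have "push_exponents (forget_below n (Suc (Suc i))) p =
              push_exponents ?g (push_exponents (forget_below n (Suc i)) p)"
        unfolding push_exponents_comp comp ..
      then show "p \<in> K (Suc (Suc i))" using p by (simp add: K_def)
    qed
    obtain c where c: "c + Poly_Mapping.single (Suc i) 1 \<in> M" "c + Poly_Mapping.single 0 1 \<in> M"
      using shift[of "Suc i"] True by auto
    define u where "u = c + Poly_Mapping.single (Suc i) 1"
    define v where "v = c + Poly_Mapping.single 0 1"
    let ?p = "monomial u - monomial v :: 'a mpol"
    have pT: "?p \<in> ?T"
      using is_subringD(4)[OF T monoT[OF c(1), folded u_def] is_subringD(3)[OF T monoT[OF c(2), folded v_def]]] by simp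
    have push: "push_exponents h ?p = monomial (h u) - monomial (h v)" for h
      using push_exponents_add[of h "monomial u" "- monomial v"]
      by (simp add: push_exponents_uminus) (simp add: monomial_def)
    have deg: "exponent_degree n u = exponent_degree n v"
    proof -
      have "exponent_degree n (Poly_Mapping.single j 1) = 1" if "j < n" for j
        using that by (simp add: exponent_degree_def lookup_single when_def)
      from this[of "Suc i"] this[of 0] show ?thesis
        using True n by (simp add: u_def v_def exponent_degree_add)
    qed
    have "forget_below n (Suc (Suc i)) u = forget_below n (Suc (Suc i)) v"
      by (rule poly_mapping_eqI) (simp add: lookup_forget_below deg, auto simp: u_def v_def lookup_add lookup_single lookup_one)
    then have "?p \<in> K (Suc (Suc i))" using pT by (simp add: K_def push)
    moreover have "?p \<notin> K (Suc i)"
    proof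
      assume "?p \<in> K (Suc i)"
      then have "(monomial (forget_below n (Suc i) u) :: 'a mpol) = monomial (forget_below n (Suc i) v)"
        by (simp add: K_def push)
      then have "forget_below n (Suc i) u = forget_below n (Suc i) v"
        using inj_monomial by (rule injD[rotated])
      then have "Poly_Mapping.lookup (forget_below n (Suc i) u) (Suc i) =
                 Poly_Mapping.lookup (forget_below n (Suc i) v) (Suc i)" by simp
      then show False using True by (simp add: lookup_forget_below u_def v_def lookup_add lookup_single lookup_one)
    qed
    ultimately show ?thesis using sub True i by (auto simp: P_def)
  next
    case False
    then have iN: "Suc i = n" using i by simp
    have sub: "Poly_Mapping.lookup p 0 = 0" if p: "p \<in> K n" for p
    proof -
      have zero: "forget_below n n b = 0 \<longleftrightarrow> b = 0" if "b \<in> Poly_Mapping.keys p" for b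
      proof
        assume "forget_below n n b = 0"
        then have "exponent_degree n b = 0" using lookup_forget_below[OF n, of n b 0] by simp
        moreover have "Poly_Mapping.keys b \<subseteq> {..<n}" using Mn[of b] p that by (auto simp: K_def toric_ring_def)
        ultimately show "b = 0" by (rule exponent_degree_eq_0[rotated])
      qed (simp add: forget_below_def exponent_degree_def)
      have "0 = Poly_Mapping.lookup (push_exponents (forget_below n n) p) 0" using p by (simp add: K_def)
      also have "\<dots> = (\<Sum>b\<in>Poly_Mapping.keys p. if b = 0 then Poly_Mapping.lookup p 0 else 0)"
        unfolding lookup_push_exponents using zero by (intro sum.cong) auto
      also have "\<dots> = Poly_Mapping.lookup p 0" by (simp add: in_keys_iff)
      finally show ?thesis by simp
    qed
    have "Poly_Mapping.keys (monomial (forget_below n n b) :: 'a mpol) \<noteq> {}"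
      by (simp add: monomial_def)
    then have "monomial (forget_below n n b) \<noteq> (0 :: 'a mpol)" by auto
    then have "monomial b \<notin> K n" by (simp add: K_def monomial_def)
    moreover have "Poly_Mapping.lookup (monomial b :: 'a mpol) 0 = 0"
      using nz(2) by (simp add: monomial_def lookup_single)
    ultimately show ?thesis using sub monoT[OF nz(1)] iN i by (auto simp: P_def K_def)
  qed
  have "enat n \<in> {enat l |l. \<exists>P. (\<forall>i\<le>l. primeideal (P i) (ring_on ?T)) \<and> (\<forall>i<l. P i \<subset> P (Suc i))}"
    using prime step by blast
  then show ?thesis unfolding krull_dim_def by (rule Sup_upper)
qed

corollary krull_dim_toric_ring:
  assumes n: "n > 0" and M0: "0 \<in> M" and Madd: "\<And>u v. u \<in> M \<Longrightarrow> v \<in> M \<Longrightarrow> u + v \<in> M"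
    and Mn: "\<And>b. b \<in> M \<Longrightarrow> Poly_Mapping.keys b \<subseteq> {..<n}"
    and nz: "b \<in> M" "b \<noteq> 0"
    and shift: "\<And>i. 0 < i \<Longrightarrow> i < n \<Longrightarrow>
        \<exists>c. c + Poly_Mapping.single i 1 \<in> M \<and> c + Poly_Mapping.single 0 1 \<in> M"
  shows "krull_dim (ring_on (toric_ring M :: 'a::field mpol set)) = enat n"
proof (rule antisym)
  show "enat n \<le> krull_dim (ring_on (toric_ring M :: 'a mpol set))"
    by (rule krull_dim_toric_ring_ge[OF n M0 Madd Mn nz shift])
  show "krull_dim (ring_on (toric_ring M :: 'a mpol set)) \<le> enat n"
  proof (rule krull_dim_subalgebra_le[OF is_subring_toric_ring[OF M0 Madd]])
    show "Poly_Mapping.single 0 c \<in> toric_ring M" for c :: 'a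
      using M0 by (auto simp: toric_ring_def)
    show "toric_ring M \<subseteq> (mpol_carrier n :: 'a mpol set)"
      using Mn by (auto simp: toric_ring_def mpol_carrier_def)
  qed
qed

section \<open>The fiber cone of an equigenerated monomial ideal\<close>

lemma exponent_degree_multiple:
  assumes "\<And>b. b \<in> B \<Longrightarrow> exponent_degree n b = d" "b \<in> exponent_multiple B j"
  shows "exponent_degree n b = j * d"
  using assms(2)
proof (induction j arbitrary: b)
  case (Suc j)
  then obtain u v where uv: "u \<in> exponent_multiple B j" "v \<in> B" "b = u + v" by (auto simp: exponent_sums_def)
  then show ?case using Suc.IH[OF uv(1)] assms(1)[OF uv(2)] by (simp add: exponent_degree_add)
qed (simp add: exponent_degree_def)

lemma exponent_multiple_add:
  assumes "u \<in> exponent_multiple B i" "v \<in> exponent_multiple B j"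
  shows "u + v \<in> exponent_multiple B (i + j)"
  using assms(2)
proof (induction j arbitrary: v)
  case 0
  then show ?case using assms(1) by simp
next
  case (Suc j)
  then obtain w b where wb: "w \<in> exponent_multiple B j" "b \<in> B" "v = w + b" by (auto simp: exponent_sums_def)
  have "(u + w) + b \<in> exponent_multiple B (Suc (i + j))"
    using Suc.IH[OF wb(1)] wb(2) by (auto simp: exponent_sums_def)
  then show ?case by (simp add: wb(3) add.assoc)
qed

lemma lookup_mult_sum_superset:
  fixes p q :: "'a::field mpol"
  assumes "finite U" "finite V" "Poly_Mapping.keys p \<subseteq> U" "Poly_Mapping.keys q \<subseteq> V"
  shows "Poly_Mapping.lookup (p * q) b =
    (\<Sum>u\<in>U. \<Sum>v\<in>V. if u + v = b then Poly_Mapping.lookup p u * Poly_Mapping.lookup q v else 0)"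
proof -
  have "Poly_Mapping.lookup (p * q) b =
      (\<Sum>u\<in>U. \<Sum>v\<in>Poly_Mapping.keys q. if u + v = b then Poly_Mapping.lookup p u * Poly_Mapping.lookup q v else 0)"
    unfolding lookup_mult_sum using assms
    by (intro sum.mono_neutral_left) (auto simp: in_keys_iff intro!: sum.neutral)
  also have "\<dots> = (\<Sum>u\<in>U. \<Sum>v\<in>V. if u + v = b then Poly_Mapping.lookup p u * Poly_Mapping.lookup q v else 0)"
    using assms by (intro sum.cong refl sum.mono_neutral_left) (auto simp: in_keys_iff)
  finally show ?thesis .
qed

text \<open>
  The coefficients of an element of the Rees ring in degree \<open>j\<close> have only terms of degree at least \<open>j d\<close>.
  The terms of degree exactly \<open>j d\<close> are kept. Their degree still tells from which \<open>j\<close> they came,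
  so adding them up over all \<open>j\<close> loses no information.
\<close>

definition initial_form :: "nat \<Rightarrow> nat \<Rightarrow> 'a::field mpol poly \<Rightarrow> 'a mpol" where
  "initial_form n d f = (\<Sum>j\<le>Polynomial.degree f. \<Sum>b\<in>Poly_Mapping.keys (Polynomial.coeff f j).
     if exponent_degree n b = j * d then Poly_Mapping.single b (Poly_Mapping.lookup (Polynomial.coeff f j) b) else 0)"

lemma lookup_initial_form:
  assumes "d > 0"
  shows "Poly_Mapping.lookup (initial_form n d f) b =
    (if d dvd exponent_degree n b
     then Poly_Mapping.lookup (Polynomial.coeff f (exponent_degree n b div d)) b else 0)"
proof -
  have *: "Poly_Mapping.lookup (\<Sum>b\<in>Poly_Mapping.keys p. if Q b then Poly_Mapping.single b (Poly_Mapping.lookup p b) else 0) b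
          = (if Q b then Poly_Mapping.lookup p b else 0)" for p :: "'a mpol" and Q
  proof -
    have "Poly_Mapping.lookup (\<Sum>b\<in>Poly_Mapping.keys p. if Q b then Poly_Mapping.single b (Poly_Mapping.lookup p b) else 0) b
            = (\<Sum>c\<in>Poly_Mapping.keys p. if c = b then (if Q b then Poly_Mapping.lookup p b else 0) else 0)"
      unfolding lookup_sum by (intro sum.cong refl) (simp add: lookup_single)
    then show ?thesis by (simp add: in_keys_iff)
  qed
  have "Poly_Mapping.lookup (initial_form n d f) b =
      (\<Sum>j\<le>Polynomial.degree f. if exponent_degree n b = j * d then Poly_Mapping.lookup (Polynomial.coeff f j) b else 0)"
    unfolding initial_form_def by (simp add: lookup_sum[of _ "{..Polynomial.degree f}"] *)
  also have "\<dots> = (if d dvd exponent_degree n b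
     then Poly_Mapping.lookup (Polynomial.coeff f (exponent_degree n b div d)) b else 0)"
  proof (cases "d dvd exponent_degree n b")
    case True
    then obtain i where i: "exponent_degree n b = i * d" by (metis dvd_def mult.commute)
    have "(\<Sum>j\<le>Polynomial.degree f. if exponent_degree n b = j * d then Poly_Mapping.lookup (Polynomial.coeff f j) b else 0)
          = (\<Sum>j\<le>Polynomial.degree f. if j = i then Poly_Mapping.lookup (Polynomial.coeff f i) b else 0)"
      using assms by (intro sum.cong) (auto simp: i)
    also have "\<dots> = Poly_Mapping.lookup (Polynomial.coeff f i) b"
      by (simp add: coeff_eq_0)
    finally show ?thesis using i assms by simp
  next
    case False
    then have "exponent_degree n b \<noteq> j * d" for j by auto
    then show ?thesis using False by simp
  qed
  finally show ?thesis .
qed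

locale equigenerated_monomial_ideal =
  fixes n d :: nat and B :: "(nat \<Rightarrow>\<^sub>0 nat) set"
  assumes d: "d > 0"
    and keys_B: "\<And>b. b \<in> B \<Longrightarrow> Poly_Mapping.keys b \<subseteq> {..<n}"
    and degree_B: "\<And>b. b \<in> B \<Longrightarrow> exponent_degree n b = d"
begin

text \<open>
  The carrier of the Rees ring, with the powers of the ideal written as monomial ideals.
\<close>

definition rees_carrier :: "'a::field mpol poly set" where
  "rees_carrier = {f. \<forall>j. Polynomial.coeff f j \<in> monomial_ideal n (exponent_multiple B j)}"

definition exponent_monoid :: "(nat \<Rightarrow>\<^sub>0 nat) set" where
  "exponent_monoid = (\<Union>j. exponent_multiple B j)"

lemma exponent_monoid_0: "0 \<in> exponent_monoid"
  unfolding exponent_monoid_def by (rule UN_I[of 0]) auto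

lemma exponent_monoid_add: "u \<in> exponent_monoid \<Longrightarrow> v \<in> exponent_monoid \<Longrightarrow> u + v \<in> exponent_monoid"
  unfolding exponent_monoid_def using exponent_multiple_add by blast

lemma keys_exponent_monoid: "b \<in> exponent_monoid \<Longrightarrow> Poly_Mapping.keys b \<subseteq> {..<n}"
  unfolding exponent_monoid_def using keys_exponent_multiple[OF keys_B] by blast

lemma generators_subset_exponent_monoid: "B \<subseteq> exponent_monoid"
  unfolding exponent_monoid_def by (intro subsetI UN_I[of 1]) (auto simp: exponent_sums_def)

lemma rees_carrier_keysE:
  assumes "f \<in> rees_carrier" "b \<in> Poly_Mapping.keys (Polynomial.coeff f j)"
  obtains c u where "c \<in> exponent_multiple B j" "b = c + u" "Poly_Mapping.keys u \<subseteq> {..<n}"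
    "exponent_degree n b = j * d + exponent_degree n u"
proof -
  have "Polynomial.coeff f j \<in> monomial_ideal n (exponent_multiple B j)" using assms(1) by (simp add: rees_carrier_def)
  then obtain c u where cu: "c \<in> exponent_multiple B j" "b = c + u" "Poly_Mapping.keys b \<subseteq> {..<n}"
    using assms(2) by (auto simp: monomial_ideal_def mpol_carrier_def)
  then show thesis
    using that[of c u] exponent_degree_multiple[OF degree_B cu(1)] by (simp add: keys_add_nat exponent_degree_add)
qed

lemma ideal_exponent_multiple: "ideal (monomial_ideal n (exponent_multiple B j)) (ring_on (mpol_carrier n :: 'a::field mpol set))"
  using ideal_monomial_ideal by (simp add: mpol_ring_eq)

lemma is_subring_rees_carrier: "is_subring (rees_carrier :: 'a::field mpol poly set)"
  unfolding is_subring_def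
proof (intro conjI ballI)
  note I = ideal_ring_onD[OF ideal_exponent_multiple, where ?'a1 = 'a]
  let ?M = "\<lambda>j. monomial_ideal n (exponent_multiple B j) :: 'a mpol set"
  show "1 \<in> (rees_carrier :: 'a mpol poly set)"
  proof -
    have "Polynomial.coeff (1 :: 'a mpol poly) j \<in> ?M j" for j
    proof (cases "j = 0")
      case True
      have "(1 :: 'a mpol) \<in> ?M 0"
        using is_subringD(2)[OF is_subring_mpol_carrier[of n, where ?'a = 'a]] by (simp add: monomial_ideal_def)
      then show ?thesis using True by simp
    next
      case False
      then show ?thesis using I(2)[of j] by (simp add: coeff_1)
    qed
    then show ?thesis by (simp add: rees_carrier_def)
  qed
  fix f g :: "'a mpol poly" assume f: "f \<in> rees_carrier" and g: "g \<in> rees_carrier"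
  show "f + g \<in> rees_carrier" using f g I(3) by (simp add: rees_carrier_def)
  have "Polynomial.coeff f i * Polynomial.coeff g (j - i) \<in> ?M j" if "i \<le> j" for i j
  proof -
    have mem: "Polynomial.coeff f i \<in> ?M i" "Polynomial.coeff g (j - i) \<in> ?M (j - i)"
      using f g by (simp_all add: rees_carrier_def)
    have "\<exists>c\<in>exponent_multiple B j. \<exists>w. b = c + w"
      if b: "b \<in> Poly_Mapping.keys (Polynomial.coeff f i * Polynomial.coeff g (j - i))" for b
    proof -
      obtain u v where uv: "u \<in> Poly_Mapping.keys (Polynomial.coeff f i)"
        "v \<in> Poly_Mapping.keys (Polynomial.coeff g (j - i))" "b = u + v" using b by (rule keys_multE)
      obtain c w where cw: "c \<in> exponent_multiple B i" "u = c + w" using rees_carrier_keysE[OF f uv(1)] by blast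
      obtain c' w' where cw': "c' \<in> exponent_multiple B (j - i)" "v = c' + w'" using rees_carrier_keysE[OF g uv(2)] by blast
      have "c + c' \<in> exponent_multiple B j" using exponent_multiple_add[OF cw(1) cw'(1)] \<open>i \<le> j\<close> by simp
      moreover have "b = (c + c') + (w + w')" by (simp add: uv(3) cw(2) cw'(2) ac_simps)
      ultimately show ?thesis by blast
    qed
    moreover have "Polynomial.coeff f i * Polynomial.coeff g (j - i) \<in> mpol_carrier n"
      using mem I(1) by (intro is_subringD(5)[OF is_subring_mpol_carrier]) blast+
    ultimately show ?thesis by (simp add: monomial_ideal_def)
  qed
  then show "f * g \<in> rees_carrier"
    unfolding rees_carrier_def mem_Collect_eq coeff_mult by (intro allI I(6)) auto
next
  note I = ideal_ring_onD[OF ideal_exponent_multiple, where ?'a1 = 'a]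
  fix f :: "'a mpol poly" assume f: "f \<in> rees_carrier"
  show "- f \<in> rees_carrier"
    using f is_subringD(3)[OF is_subring_mpol_carrier[of n, where ?'a = 'a]]
    by (simp add: rees_carrier_def monomial_ideal_def keys_uminus)
qed

lemma initial_form_add: "initial_form n d (f + g) = initial_form n d f + initial_form n d (g :: 'a::field mpol poly)"
  by (rule poly_mapping_eqI) (simp add: lookup_initial_form[OF d] lookup_add)

lemma initial_form_1: "initial_form n d (1 :: 'a::field mpol poly) = 1"
proof (rule poly_mapping_eqI)
  fix b
  have "exponent_degree n (0 :: nat \<Rightarrow>\<^sub>0 nat) = 0" by (simp add: exponent_degree_def)
  then show "Poly_Mapping.lookup (initial_form n d (1 :: 'a mpol poly)) b = Poly_Mapping.lookup 1 b"
    by (cases "b = 0") (auto simp: lookup_initial_form[OF d] coeff_1 lookup_one)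
qed

text \<open>
  A term of degree \<open>j d\<close> of the coefficient of \<open>f * g\<close> in degree \<open>j\<close> can only be the product of terms of the
  least possible degrees \<open>i d\<close> and \<open>(j - i) d\<close>, since smaller degrees do not occur in the factors.
\<close>

lemma initial_form_mult:
  fixes f g :: "'a::field mpol poly"
  assumes f: "f \<in> rees_carrier" and g: "g \<in> rees_carrier"
  shows "initial_form n d (f * g) = initial_form n d f * initial_form n d g"
proof (rule poly_mapping_eqI)
  fix b
  let ?deg = "exponent_degree n" and ?F = "initial_form n d f" and ?G = "initial_form n d g"
  let ?f = "\<lambda>i u. Poly_Mapping.lookup (Polynomial.coeff f i) u"
    and ?g = "\<lambda>i u. Poly_Mapping.lookup (Polynomial.coeff g i) u"
  have f0: "?f i u = 0" if "?deg u < i * d" for i u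
  proof (rule ccontr)
    assume "?f i u \<noteq> 0"
    then have "u \<in> Poly_Mapping.keys (Polynomial.coeff f i)" by (simp add: in_keys_iff)
    then show False using rees_carrier_keysE[OF f] that by (metis not_add_less1)
  qed
  have g0: "?g i u = 0" if "?deg u < i * d" for i u
  proof (rule ccontr)
    assume "?g i u \<noteq> 0"
    then have "u \<in> Poly_Mapping.keys (Polynomial.coeff g i)" by (simp add: in_keys_iff)
    then show False using rees_carrier_keysE[OF g] that by (metis not_add_less1)
  qed
  show "Poly_Mapping.lookup (initial_form n d (f * g)) b = Poly_Mapping.lookup (?F * ?G) b"
  proof (cases "d dvd ?deg b")
    case False
    have "(if u + v = b then Poly_Mapping.lookup ?F u * Poly_Mapping.lookup ?G v else 0) = 0" for u v
      using False by (auto simp: lookup_initial_form[OF d] exponent_degree_add)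
    then have "Poly_Mapping.lookup (?F * ?G) b = 0" unfolding lookup_mult_sum by simp
    then show ?thesis using False by (simp add: lookup_initial_form[OF d])
  next
    case True
    then obtain j where j: "?deg b = j * d" by (metis dvd_def mult.commute)
    \<comment> \<open>Common finite index sets for all products that occur, so that the sums can be interchanged.\<close>
    define U where "U = Poly_Mapping.keys ?F \<union> (\<Union>i\<le>j. Poly_Mapping.keys (Polynomial.coeff f i))"
    define V where "V = Poly_Mapping.keys ?G \<union> (\<Union>i\<le>j. Poly_Mapping.keys (Polynomial.coeff g i))"
    have fin: "finite U" "finite V" by (auto simp: U_def V_def)
    have inner: "(\<Sum>i\<le>j. ?f i u * ?g (j - i) v) = Poly_Mapping.lookup ?F u * Poly_Mapping.lookup ?G v"
      if uv: "u + v = b" for u v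
    proof -
      have deg: "?deg u + ?deg v = j * d" using j uv by (auto simp: exponent_degree_add)
      show ?thesis
      proof (cases "d dvd ?deg u")
        case True
        then obtain i0 where i0: "?deg u = i0 * d" by (metis dvd_def mult.commute)
        have le: "i0 \<le> j" using deg i0 d by (metis le_add1 mult_le_cancel2)
        have dv: "?deg v = (j - i0) * d" using deg i0 by (simp add: diff_mult_distrib)
        have "?f i u * ?g (j - i) v = (if i = i0 then ?f i0 u * ?g (j - i0) v else 0)" if "i \<le> j" for i
        proof (cases i i0 rule: linorder_cases)
          case less
          then have "j - i0 < j - i" using le by simp
          then have "?deg v < (j - i) * d" using d dv by simp
          then show ?thesis using g0 less by simp
        next
          case greater
          then have "?deg u < i * d" using d i0 by simp
          then show ?thesis using f0 greater by simp
        qed simp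
        then have "(\<Sum>i\<le>j. ?f i u * ?g (j - i) v) = (\<Sum>i\<le>j. if i = i0 then ?f i0 u * ?g (j - i0) v else 0)"
          by (intro sum.cong) auto
        also have "\<dots> = ?f i0 u * ?g (j - i0) v" using le by simp
        finally show ?thesis using d by (simp add: lookup_initial_form[OF d] i0 dv)
      next
        case False
        have "?f i u * ?g (j - i) v = 0" if "i \<le> j" for i
        proof (cases "?deg u < i * d")
          case True
          then show ?thesis using f0 by simp
        next
          case F: False
          have "?deg u \<noteq> i * d" using False by auto
          then have "i * d < ?deg u" using F by simp
          moreover have "(j - i) * d + i * d = j * d" using that by (simp flip: add_mult_distrib)
          ultimately have "?deg v < (j - i) * d" using deg by linarith
          then show ?thesis using g0 by simp
        qed
        then have "(\<Sum>i\<le>j. ?f i u * ?g (j - i) v) = 0" by (intro sum.neutral) auto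
        then show ?thesis using False by (simp add: lookup_initial_form[OF d])
      qed
    qed
    have "Poly_Mapping.lookup (initial_form n d (f * g)) b =
            (\<Sum>i\<le>j. Poly_Mapping.lookup (Polynomial.coeff f i * Polynomial.coeff g (j - i)) b)"
      using d by (simp add: lookup_initial_form[OF d] j coeff_mult lookup_sum)
    also have "\<dots> = (\<Sum>i\<le>j. \<Sum>u\<in>U. \<Sum>v\<in>V. if u + v = b then ?f i u * ?g (j - i) v else 0)"
    proof (intro sum.cong refl lookup_mult_sum_superset fin)
      fix i assume "i \<in> {..j}"
      then show "Poly_Mapping.keys (Polynomial.coeff f i) \<subseteq> U" by (auto simp: U_def)
      have "j - i \<le> j" by simp
      then show "Poly_Mapping.keys (Polynomial.coeff g (j - i)) \<subseteq> V" unfolding V_def by blast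
    qed
    also have "\<dots> = (\<Sum>u\<in>U. \<Sum>i\<le>j. \<Sum>v\<in>V. if u + v = b then ?f i u * ?g (j - i) v else 0)"
      by (rule sum.swap)
    also have "\<dots> = (\<Sum>u\<in>U. \<Sum>v\<in>V. \<Sum>i\<le>j. if u + v = b then ?f i u * ?g (j - i) v else 0)"
      by (intro sum.cong refl sum.swap)
    also have "\<dots> = (\<Sum>u\<in>U. \<Sum>v\<in>V. if u + v = b then Poly_Mapping.lookup ?F u * Poly_Mapping.lookup ?G v else 0)"
      using inner by (intro sum.cong refl) auto
    also have "\<dots> = Poly_Mapping.lookup (?F * ?G) b"
      by (rule lookup_mult_sum_superset[symmetric]) (use fin in \<open>auto simp: U_def V_def\<close>)
    finally show ?thesis .
  qed
qed

lemma initial_form_image: "initial_form n d ` rees_carrier = (toric_ring exponent_monoid :: 'a::field mpol set)"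
proof
  show "initial_form n d ` rees_carrier \<subseteq> (toric_ring exponent_monoid :: 'a mpol set)"
  proof
    fix p :: "'a mpol" assume "p \<in> initial_form n d ` rees_carrier"
    then obtain f where f: "f \<in> rees_carrier" "p = initial_form n d f" by blast
    have "b \<in> exponent_monoid" if b: "b \<in> Poly_Mapping.keys p" for b
    proof -
      let ?j = "exponent_degree n b div d"
      have dv: "d dvd exponent_degree n b" and "Poly_Mapping.lookup (Polynomial.coeff f ?j) b \<noteq> 0"
        using b by (auto simp: f(2) in_keys_iff lookup_initial_form[OF d] split: if_splits)
      then have "b \<in> Poly_Mapping.keys (Polynomial.coeff f ?j)" by (simp add: in_keys_iff)
      then obtain c u where cu: "c \<in> exponent_multiple B ?j" "b = c + u" "Poly_Mapping.keys u \<subseteq> {..<n}"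
        "exponent_degree n b = ?j * d + exponent_degree n u" by (rule rees_carrier_keysE[OF f(1)])
      have "exponent_degree n u = 0" using cu(4) dv by simp
      then have "u = 0" by (rule exponent_degree_eq_0[OF cu(3)])
      then show ?thesis using cu by (auto simp: exponent_monoid_def)
    qed
    then show "p \<in> toric_ring exponent_monoid" by (auto simp: toric_ring_def)
  qed
  show "(toric_ring exponent_monoid :: 'a mpol set) \<subseteq> initial_form n d ` rees_carrier"
  proof
    fix p :: "'a mpol" assume p: "p \<in> toric_ring exponent_monoid"
    define f where "f = (\<Sum>b\<in>Poly_Mapping.keys p.
        Polynomial.monom (Poly_Mapping.single b (Poly_Mapping.lookup p b)) (exponent_degree n b div d))"
    have cf: "Polynomial.coeff f j = (\<Sum>b\<in>Poly_Mapping.keys p.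
        if exponent_degree n b div d = j then Poly_Mapping.single b (Poly_Mapping.lookup p b) else 0)" for j
      by (simp add: f_def coeff_sum)
    have lf: "Poly_Mapping.lookup (Polynomial.coeff f j) b =
        (if exponent_degree n b div d = j then Poly_Mapping.lookup p b else 0)" for j b
    proof -
      have "Poly_Mapping.lookup (Polynomial.coeff f j) b = (\<Sum>c\<in>Poly_Mapping.keys p. if c = b then
          (if exponent_degree n b div d = j then Poly_Mapping.lookup p b else 0) else 0)"
        unfolding cf lookup_sum by (intro sum.cong refl) (simp add: lookup_single)
      then show ?thesis by (simp add: in_keys_iff)
    qed
    have M: "\<exists>j. b \<in> exponent_multiple B j \<and> exponent_degree n b = j * d" if b: "b \<in> Poly_Mapping.keys p" for b
    proof -
      obtain j where "b \<in> exponent_multiple B j"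
        using p b by (auto simp: toric_ring_def exponent_monoid_def)
      then show ?thesis using exponent_degree_multiple[OF degree_B] by blast
    qed
    have "Polynomial.coeff f j \<in> monomial_ideal n (exponent_multiple B j)" for j
    proof -
      have b: "b \<in> exponent_multiple B j" if "b \<in> Poly_Mapping.keys (Polynomial.coeff f j)" for b
      proof -
        have "b \<in> Poly_Mapping.keys p" "exponent_degree n b div d = j"
          using that by (auto simp: in_keys_iff lf split: if_splits)
        then show ?thesis using M[of b] d by auto
      qed
      then have "\<exists>c\<in>exponent_multiple B j. \<exists>u. b = c + u" if "b \<in> Poly_Mapping.keys (Polynomial.coeff f j)" for b
        using that by (intro bexI[of _ b] exI[of _ 0]) auto
      moreover have "Polynomial.coeff f j \<in> mpol_carrier n"
        using b keys_exponent_multiple[OF keys_B] unfolding mpol_carrier_def by blast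
      ultimately show ?thesis by (simp add: monomial_ideal_def)
    qed
    then have "f \<in> rees_carrier" by (simp add: rees_carrier_def)
    moreover have "initial_form n d f = p"
    proof (rule poly_mapping_eqI)
      fix b
      show "Poly_Mapping.lookup (initial_form n d f) b = Poly_Mapping.lookup p b"
      proof (cases "b \<in> Poly_Mapping.keys p")
        case True
        then show ?thesis using M[OF True] by (auto simp: lookup_initial_form[OF d] lf)
      next
        case False
        then show ?thesis by (simp add: lookup_initial_form[OF d] lf in_keys_iff)
      qed
    qed
    ultimately show "p \<in> initial_form n d ` rees_carrier" by blast
  qed
qed

definition variable_exponents :: "(nat \<Rightarrow>\<^sub>0 nat) set" where
  "variable_exponents = {Poly_Mapping.single i 1 |i. i < n}"

text \<open>
  An exponent that occurs in the coefficient of degree \<open>j\<close> is \<open>c + u\<close> with \<open>c\<close> of degree \<open>j d\<close>. It is invisible in the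
  initial form iff \<open>u\<close> is nonzero, that is, iff a variable can be split off.
\<close>

lemma initial_form_kernel:
  fixes f :: "'a::field mpol poly"
  assumes f: "f \<in> rees_carrier"
  shows "initial_form n d f = 0 \<longleftrightarrow>
    (\<forall>j. Polynomial.coeff f j \<in> monomial_ideal n (exponent_sums variable_exponents (exponent_multiple B j)))"
proof
  assume zero: "initial_form n d f = 0"
  show "\<forall>j. Polynomial.coeff f j \<in> monomial_ideal n (exponent_sums variable_exponents (exponent_multiple B j))"
  proof
    fix j
    have "\<exists>c\<in>exponent_sums variable_exponents (exponent_multiple B j). \<exists>w. b = c + w"
      if b: "b \<in> Poly_Mapping.keys (Polynomial.coeff f j)" for b
    proof -
      obtain c u where cu: "c \<in> exponent_multiple B j" "b = c + u" "Poly_Mapping.keys u \<subseteq> {..<n}"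
        "exponent_degree n b = j * d + exponent_degree n u" using b by (rule rees_carrier_keysE[OF f])
      have "u \<noteq> 0"
      proof
        assume "u = 0"
        then have "exponent_degree n b = j * d" using cu(4) by (simp add: exponent_degree_def)
        then have "Poly_Mapping.lookup (initial_form n d f) b = Poly_Mapping.lookup (Polynomial.coeff f j) b"
          using d by (simp add: lookup_initial_form[OF d])
        then show False using zero b by (simp add: in_keys_iff)
      qed
      then obtain i where i: "i \<in> Poly_Mapping.keys u"
        by (metis keys_eq_empty ex_in_conv)
      define w where "w = u - Poly_Mapping.single i 1"
      have "u = Poly_Mapping.single i 1 + w"
        using i by (intro poly_mapping_eqI) (auto simp: w_def lookup_add lookup_minus lookup_single when_def in_keys_iff)
      then have "b = (Poly_Mapping.single i 1 + c) + w" using cu(2) by (simp add: ac_simps)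
      moreover have "Poly_Mapping.single i 1 + c \<in> exponent_sums variable_exponents (exponent_multiple B j)"
        using i cu by (auto simp: exponent_sums_def variable_exponents_def)
      ultimately show ?thesis by blast
    qed
    moreover have "Polynomial.coeff f j \<in> mpol_carrier n" using f by (simp add: rees_carrier_def monomial_ideal_def)
    ultimately show "Polynomial.coeff f j \<in> monomial_ideal n (exponent_sums variable_exponents (exponent_multiple B j))"
      by (simp add: monomial_ideal_def)
  qed
next
  assume mem: "\<forall>j. Polynomial.coeff f j \<in> monomial_ideal n (exponent_sums variable_exponents (exponent_multiple B j))"
  show "initial_form n d f = 0"
  proof (rule poly_mapping_eqI)
    fix b
    show "Poly_Mapping.lookup (initial_form n d f) b = Poly_Mapping.lookup 0 b"
    proof (cases "d dvd exponent_degree n b")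
      case True
      then obtain j where j: "exponent_degree n b = j * d" by (metis dvd_def mult.commute)
      have "b \<notin> Poly_Mapping.keys (Polynomial.coeff f j)"
      proof
        assume "b \<in> Poly_Mapping.keys (Polynomial.coeff f j)"
        then obtain i c w where "i < n" "c \<in> exponent_multiple B j" "b = (Poly_Mapping.single i 1 + c) + w"
          using mem[rule_format, of j]
          unfolding monomial_ideal_def exponent_sums_def variable_exponents_def by blast
        moreover have "exponent_degree n (Poly_Mapping.single i 1) = 1"
          using \<open>i < n\<close> by (simp add: exponent_degree_def lookup_single when_def)
        ultimately show False
          using exponent_degree_multiple[OF degree_B] j by (simp add: exponent_degree_add)
      qed
      then show ?thesis using d by (simp add: lookup_initial_form[OF d] j in_keys_iff)
    qed (simp add: lookup_initial_form[OF d])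
  qed
qed

text \<open>
  By the homomorphism theorem applied to \<open>initial_form\<close>.
\<close>

theorem krull_dim_fiber_cone:
  "krull_dim (fiber_cone n (monomial_ideal n B :: 'a::field mpol set)) =
     krull_dim (ring_on (toric_ring exponent_monoid :: 'a mpol set))"
proof -
  let ?R = "rees_carrier :: 'a mpol poly set" and ?T = "toric_ring exponent_monoid :: 'a mpol set"
  let ?\<phi> = "initial_form n d :: 'a mpol poly \<Rightarrow> 'a mpol"
  have T: "is_subring ?T" by (rule is_subring_toric_ring[OF exponent_monoid_0 exponent_monoid_add])
  have R: "is_subring ?R" by (rule is_subring_rees_carrier)
  have hom: "?\<phi> \<in> ring_hom (ring_on ?R) (ring_on ?T)"
    by (rule ring_hom_memI)
      (use initial_form_image[where ?'a = 'a] in \<open>auto simp: initial_form_add initial_form_mult initial_form_1\<close>)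
  interpret ring_hom_ring "ring_on ?R" "ring_on ?T" ?\<phi>
    by (rule ring_hom_ringI2[OF ring_ring_on[OF R] ring_ring_on[OF T] hom])
  have "variables_ideal n = (monomial_ideal n variable_exponents :: 'a mpol set)"
  proof -
    have "{monomial (Poly_Mapping.single i 1) | i. i < n} = (monomial ` variable_exponents :: 'a mpol set)"
      by (auto simp: variable_exponents_def)
    moreover have "Idl\<^bsub>mpol_ring n\<^esub> (monomial ` variable_exponents) = (monomial_ideal n variable_exponents :: 'a mpol set)"
      by (rule genideal_monomials) (auto simp: variable_exponents_def split: if_splits)
    ultimately show ?thesis by (simp add: variables_ideal_def)
  qed
  then have prod: "ideal_prod (mpol_ring n) (variables_ideal n) (ideal_power (mpol_ring n) (monomial_ideal n B) j) =
      (monomial_ideal n (exponent_sums variable_exponents (exponent_multiple B j)) :: 'a mpol set)" for j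
    using keys_exponent_multiple[OF keys_B] ideal_power_monomial_ideal[OF keys_B, where ?'a = 'a]
    by (simp, intro ideal_prod_monomial_ideal) (auto simp: variable_exponents_def split: if_splits)
  have rees: "rees_ring n (monomial_ideal n B :: 'a mpol set) = ring_on ?R"
    by (simp add: rees_ring_def graded_sum_def rees_carrier_def ideal_power_monomial_ideal[OF keys_B])
  have sub: "f \<in> ?R" if "\<forall>j. Polynomial.coeff f j \<in> monomial_ideal n (exponent_sums variable_exponents (exponent_multiple B j))" for f
  proof -
    have "monomial_ideal n (exponent_sums variable_exponents (exponent_multiple B j)) \<subseteq> (monomial_ideal n (exponent_multiple B j) :: 'a mpol set)" for j
    proof
      fix p :: "'a mpol" assume p: "p \<in> monomial_ideal n (exponent_sums variable_exponents (exponent_multiple B j))"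
      have "\<exists>c\<in>exponent_multiple B j. \<exists>u. b = c + u" if b: "b \<in> Poly_Mapping.keys p" for b
      proof -
        obtain v c w where "c \<in> exponent_multiple B j" "b = (v + c) + w"
          using p b unfolding monomial_ideal_def exponent_sums_def by blast
        then show ?thesis by (intro bexI[of _ c] exI[of _ "v + w"]) (simp_all add: ac_simps)
      qed
      then show "p \<in> monomial_ideal n (exponent_multiple B j)" using p by (simp add: monomial_ideal_def)
    qed
    then show ?thesis using that by (auto simp: rees_carrier_def)
  qed
  have ker: "graded_sum (\<lambda>j. ideal_prod (mpol_ring n) (variables_ideal n) (ideal_power (mpol_ring n) (monomial_ideal n B) j))
               = a_kernel (ring_on ?R) (ring_on ?T) ?\<phi>"
    unfolding graded_sum_def prod a_kernel_def' using sub initial_form_kernel by auto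
  have fc: "fiber_cone n (monomial_ideal n B :: 'a mpol set) =
      ring_on ?R Quot a_kernel (ring_on ?R) (ring_on ?T) ?\<phi>"
    unfolding fiber_cone_def rees ker ..
  have iso: "(\<lambda>A. the_elem (?\<phi> ` A)) \<in> ring_iso (fiber_cone n (monomial_ideal n B)) (ring_on ?T)"
    unfolding fc by (rule FactRing_iso_set) (simp add: initial_form_image)
  have "cring (fiber_cone n (monomial_ideal n B :: 'a mpol set))"
    unfolding fc by (rule ideal.quotient_is_cring[OF kernel_is_ideal cring_ring_on[OF R]])
  then show ?thesis using cring_ring_on[OF T] iso by (rule krull_dim_ring_iso)
qed

end

section \<open>Veronese type ideals\<close>

definition veronese_exponents :: "nat \<Rightarrow> nat \<Rightarrow> nat \<Rightarrow> (nat \<Rightarrow>\<^sub>0 nat) set" where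
  "veronese_exponents k n d = {b. Poly_Mapping.keys b \<subseteq> {..<n} \<and>
     (\<Sum>i<n. Poly_Mapping.lookup b i) = d \<and> (\<forall>i<n. Poly_Mapping.lookup b i \<le> k)}"

lemma veronese_exponents_iff:
  "b \<in> veronese_exponents k n d \<longleftrightarrow> Poly_Mapping.lookup b \<in> bounded_vectors k n d"
proof
  assume b: "b \<in> veronese_exponents k n d"
  have "Poly_Mapping.lookup b i = 0" if "n \<le> i" for i
  proof -
    have "i \<notin> Poly_Mapping.keys b" using b that by (auto simp: veronese_exponents_def)
    then show ?thesis by (simp add: in_keys_iff)
  qed
  then show "Poly_Mapping.lookup b \<in> bounded_vectors k n d"
    using b by (intro bounded_vectorsI) (auto simp: veronese_exponents_def)
next
  assume b: "Poly_Mapping.lookup b \<in> bounded_vectors k n d"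
  have "i < n" if "i \<in> Poly_Mapping.keys b" for i
  proof (rule ccontr)
    assume "\<not> i < n"
    then have "Poly_Mapping.lookup b i = 0" using bounded_vectorsD(1)[OF b, of i] by simp
    then show False using that by (simp add: in_keys_iff)
  qed
  then show "b \<in> veronese_exponents k n d"
    unfolding veronese_exponents_def
    by (intro CollectI conjI allI impI subsetI bounded_vectorsD(2,3)[OF b]) simp
qed

lemma exponent_of_vector:
  fixes f :: "nat \<Rightarrow> nat" and n :: nat
  assumes "\<And>i. i \<ge> n \<Longrightarrow> f i = 0"
  obtains b where "Poly_Mapping.lookup b = f"
proof -
  have "finite {i. f i \<noteq> 0}"
  proof (rule finite_subset)
    show "{i. f i \<noteq> 0} \<subseteq> {..<n}" proof
      fix i assume "i \<in> {i. f i \<noteq> 0}"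
      then have "\<not> n \<le> i" using assms[of i] by auto
      then show "i \<in> {..<n}" by simp
    qed
  qed simp
  then show thesis by (intro that[of "Abs_poly_mapping f"] lookup_Abs_poly_mapping)
qed

lemma bij_betw_veronese_exponents:
  "bij_betw Poly_Mapping.lookup (veronese_exponents k n d) (bounded_vectors k n d)"
  unfolding bij_betw_def
proof
  show "inj_on Poly_Mapping.lookup (veronese_exponents k n d)"
    by (rule inj_onI) simp
  show "Poly_Mapping.lookup ` veronese_exponents k n d = bounded_vectors k n d"
  proof (intro equalityI subsetI)
    fix f assume f: "f \<in> bounded_vectors k n d"
    obtain b where "Poly_Mapping.lookup b = f"
      by (rule exponent_of_vector[of n f, OF bounded_vectorsD(1)[OF f]])
    then show "f \<in> Poly_Mapping.lookup ` veronese_exponents k n d"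
      using f by (auto simp: veronese_exponents_iff)
  qed (auto simp: veronese_exponents_iff)
qed

lemma card_veronese_exponents: "card (veronese_exponents k n d) = card (bounded_vectors k n d)"
  by (rule bij_betw_same_card[OF bij_betw_veronese_exponents])

lemma finite_veronese_exponents: "finite (veronese_exponents k n d)"
  using bij_betw_finite[OF bij_betw_veronese_exponents] finite_bounded_vectors by blast

lemma exponent_sums_veronese_exponents:
  "exponent_sums (veronese_exponents k n d) (veronese_exponents k n d) = veronese_exponents (2 * k) n (2 * d)"
proof (intro equalityI subsetI)
  fix s assume "s \<in> exponent_sums (veronese_exponents k n d) (veronese_exponents k n d)"
  then obtain a b where ab: "a \<in> veronese_exponents k n d" "b \<in> veronese_exponents k n d" "s = a + b"
    by (auto simp: exponent_sums_def)
  have "Poly_Mapping.lookup s = (\<lambda>i. Poly_Mapping.lookup a i + Poly_Mapping.lookup b i)"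
    by (auto simp: ab(3) lookup_add)
  then have "Poly_Mapping.lookup s \<in> bounded_vectors (2 * k) n (2 * d)"
    using ab(1,2) unfolding bounded_vectors_double veronese_exponents_iff by blast
  then show "s \<in> veronese_exponents (2 * k) n (2 * d)" by (simp add: veronese_exponents_iff)
next
  fix s assume "s \<in> veronese_exponents (2 * k) n (2 * d)"
  then obtain f g where fg: "f \<in> bounded_vectors k n d" "g \<in> bounded_vectors k n d"
    "Poly_Mapping.lookup s = (\<lambda>i. f i + g i)"
    unfolding veronese_exponents_iff bounded_vectors_double by blast
  obtain a where a: "Poly_Mapping.lookup a = f" 
    by (rule exponent_of_vector[of n f, OF bounded_vectorsD(1)[OF fg(1)]])
  obtain b where b: "Poly_Mapping.lookup b = g" 
    by (rule exponent_of_vector[of n g, OF bounded_vectorsD(1)[OF fg(2)]])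
  have "s = a + b" by (rule poly_mapping_eqI) (simp add: fg(3) a b lookup_add)
  then show "s \<in> exponent_sums (veronese_exponents k n d) (veronese_exponents k n d)"
    using fg a b by (auto simp: exponent_sums_def veronese_exponents_iff)
qed

lemma veronese_ideal_eq: "veronese_ideal k n d = (monomial_ideal n (veronese_exponents k n d) :: 'a::field mpol set)"
proof -
  have "veronese_ideal k n d = Idl\<^bsub>mpol_ring n\<^esub> (monomial ` veronese_exponents k n d :: 'a mpol set)"
    unfolding veronese_ideal_def veronese_exponents_def by (rule arg_cong[where f = "genideal (mpol_ring n)"]) blast
  also have "\<dots> = monomial_ideal n (veronese_exponents k n d)"
    by (rule genideal_monomials) (simp add: veronese_exponents_def)
  finally show ?thesis .
qed

text \<open>
  Lowering the bounds of the coordinates \<open>0\<close> and \<open>i\<close> by one leaves room for a vector of sum \<open>d - 1\<close>, since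
  \<open>d - 1 \<le> k n - 2\<close>; then one unit can be added to either of the two coordinates.
\<close>

lemma veronese_exponents_exchange:
  assumes "0 < i" "i < n" "d > 0" "d < k * n"
  shows "\<exists>c. c + Poly_Mapping.single i 1 \<in> veronese_exponents k n d \<and>
             c + Poly_Mapping.single 0 1 \<in> veronese_exponents k n d"
proof -
  have k: "k > 0" using assms by (cases k) auto
  let ?u = "\<lambda>l. if l = 0 \<or> l = i then k - 1 else k"
  have "(\<Sum>l<n. ?u l) + 2 = k * n"
  proof -
    have "(\<Sum>l<n. ?u l + of_bool (l \<in> {0, i})) = (\<Sum>l<n. k)"
      using k by (intro sum.cong) auto
    moreover have "(\<Sum>l<n. (of_bool (l \<in> {0, i}) :: nat)) = (\<Sum>l\<in>{0, i}. 1)"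
      using assms by (intro sum.mono_neutral_cong_right) auto
    ultimately show ?thesis using assms(1) by (simp add: sum.distrib mult.commute)
  qed
  then have "d - 1 \<le> (\<Sum>l<n. ?u l)" using assms(4) by linarith
  from sum_below_bounds_ex[OF this] obtain f :: "nat \<Rightarrow> nat" where
    f: "(\<forall>l. f l \<le> ?u l) \<and> (\<forall>l\<ge>n. f l = 0) \<and> (\<Sum>l<n. f l) = d - 1" ..
  obtain c where c: "Poly_Mapping.lookup c = f" by (rule exponent_of_vector[of n f]) (use f in auto)
  have "c + Poly_Mapping.single j 1 \<in> veronese_exponents k n d" if j: "j = 0 \<or> j = i" for j
    unfolding veronese_exponents_iff
  proof (rule bounded_vectorsI)
    have jn: "j < n" using j assms by auto
    fix l
    show "Poly_Mapping.lookup (c + Poly_Mapping.single j 1) l = 0" if "n \<le> l"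
      using that f jn by (simp add: lookup_add c lookup_single)
    have "f l \<le> ?u l" using f by blast
    then show "Poly_Mapping.lookup (c + Poly_Mapping.single j 1) l \<le> k"
      using k j by (cases "l = j") (auto simp: lookup_add c lookup_single split: if_splits)
  next
    have jn: "j < n" using j assms by auto
    have "(\<Sum>l<n. Poly_Mapping.lookup (c + Poly_Mapping.single j 1) l) =
          (\<Sum>l<n. f l) + (\<Sum>l<n. if l = j then 1 else 0)"
      unfolding sum.distrib[symmetric] by (intro sum.cong) (auto simp: lookup_add c lookup_single)
    also have "\<dots> = d" using f jn assms(3) by simp
    finally show "(\<Sum>l<n. Poly_Mapping.lookup (c + Poly_Mapping.single j 1) l) = d" .
  qed
  then show ?thesis by blast
qed

lemma analytic_spread_veronese_ideal:
  assumes "n \<ge> 2" "d > 0" "d < k * n"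
  shows "analytic_spread n (veronese_ideal k n d :: 'a::field mpol set) = enat n"
proof -
  interpret equigenerated_monomial_ideal n d "veronese_exponents k n d"
    by unfold_locales (use assms in \<open>auto simp: veronese_exponents_def exponent_degree_def\<close>)
  have shift: "\<exists>c. c + Poly_Mapping.single i 1 \<in> exponent_monoid \<and> c + Poly_Mapping.single 0 1 \<in> exponent_monoid"
    if "0 < i" "i < n" for i
    using veronese_exponents_exchange[OF that assms(2,3)] generators_subset_exponent_monoid by blast
  obtain c where c: "c + Poly_Mapping.single 1 1 \<in> exponent_monoid" using shift[of 1] assms(1) by auto
  have "c + Poly_Mapping.single 1 1 \<noteq> 0"
  proof
    assume "c + Poly_Mapping.single 1 1 = 0"
    then have "Poly_Mapping.lookup (c + Poly_Mapping.single 1 1) 1 = 0" by simp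
    then show False by (simp add: lookup_add)
  qed
  with c have "krull_dim (ring_on (toric_ring exponent_monoid :: 'a mpol set)) = enat n"
    using assms(1) shift exponent_monoid_0 exponent_monoid_add keys_exponent_monoid
    by (intro krull_dim_toric_ring) auto
  then show ?thesis
    unfolding analytic_spread_def veronese_ideal_eq krull_dim_fiber_cone .
qed

lemma min_num_gens_veronese_ideal:
  "min_num_gens (mpol_ring n) (veronese_ideal k n d :: 'a::field mpol set) = card (bounded_vectors k n d)"
  unfolding veronese_ideal_eq card_veronese_exponents[symmetric]
  by (rule min_num_gens_monomial_ideal[OF finite_veronese_exponents])
    (auto simp: veronese_exponents_def exponent_degree_def)

lemma veronese_ideal_square:
  "ideal_power (mpol_ring n) (veronese_ideal k n d) 2 = (veronese_ideal (2 * k) n (2 * d) :: 'a::field mpol set)"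
proof -
  have "exponent_multiple (veronese_exponents k n d) 2 = veronese_exponents (2 * k) n (2 * d)"
    unfolding exponent_sums_veronese_exponents[symmetric] by (simp add: numeral_2_eq_2 exponent_sums_def)
  moreover have "ideal_power (mpol_ring n) (monomial_ideal n (veronese_exponents k n d)) 2 =
      (monomial_ideal n (exponent_multiple (veronese_exponents k n d) 2) :: 'a mpol set)"
    by (rule ideal_power_monomial_ideal) (simp add: veronese_exponents_def)
  ultimately show ?thesis unfolding veronese_ideal_eq by simp
qed

theorem theorem3p5:
  fixes k n d :: nat
  assumes "k \<ge> 3" and "n > 0" and "d > 0"
    and "k \<le> d" and "d < k * n"
  shows "freiman n (veronese_ideal k n d :: 'a::field mpol set) \<longleftrightarrow>
    (n = 2 \<and> d \<in> {k..2 * k - 1}) \<or>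
    (n = 3 \<and> (d = 3 * k - 2 \<or> d = 3 * k - 1)) \<or>
    (n \<ge> 4 \<and> d = k * n - 1)"
proof -
  have "n \<noteq> 1" using assms by auto
  then have n: "n \<ge> 2" using assms(2) by linarith
  have "freiman n (veronese_ideal k n d :: 'a mpol set) \<longleftrightarrow>
      int (card (bounded_vectors (2 * k) n (2 * d))) =
        int n * int (card (bounded_vectors k n d)) - int (n choose 2)"
    unfolding freiman_def analytic_spread_veronese_ideal[OF n assms(3,5)] veronese_ideal_square
      min_num_gens_veronese_ideal by simp
  also have "\<dots> \<longleftrightarrow> (n = 2 \<and> d \<in> {k..2 * k - 1}) \<or>
      (n = 3 \<and> (d = 3 * k - 2 \<or> d = 3 * k - 1)) \<or> (n \<ge> 4 \<and> d = k * n - 1)"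
    by (rule card_bounded_vectors_double_eq_iff[OF assms(1,4,5)])
  finally show ?thesis .
qed

end
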